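(* Let $\lambda$ be an infinite cardinal and let $\kappa$ be a cardinal. If $\kappa$ satisfies the Hindman-Schur condition with unmeshedness for $\lambda$, then $\kappa\to(\lambda)^2_2$.
   Context: $[\kappa]^{<\omega}$ denotes the set of finite subsets of $\kappa$, where $\kappa$ is identified with an initial ordinal and carries its ordinal ordering. A coloring of a set $S$ in $3$ colors is a function $c:S\to\{0,1,2\}$; a subset of $S$ is monochromatic under $c$ if $c$ is constant on it. For a set $A$ of positive integers and a family $H$ of sets, $FU^A(H)$ denotes the set of all unions $x_1\cup\dots\cup x_j$ of $j$ many distinct members $x_1,\dots,x_j$ of $H$, for $j\in A$. Two finite non-empty subsets $x,y$ of $\kappa$ are unmeshed if either $\max x<\min y$ or $\max y<\min x$. A family of finite non-empty subsets of $\kappa$ is unmeshed (pairwise unmeshed) if any two distinct members of it are unmeshed. A cardinal $\kappa$ satisfies the Hindman-Schur condition with unmeshedness for a cardinal $\lambda$ if: for every coloring $c$ of $[\kappa]^{<\omega}$ in $3$ colors, there exist an unmeshed family $H$ of finite subsets of $\kappa$ of cardinality $\lambda$ and positive integers $a,b$ such that $FU^{\{a,b,a+b\}}(H)$ is monochromatic under $c$. The notation $\kappa\to(\lambda)^2_2$ means: if the pairs (two-element subsets) of a set of cardinality $\kappa$ are colored in two colors, then there exists a subset of cardinality $\lambda$ all of whose pairs have the same color. *)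

theory Defs
  imports Main "HOL-Library.FuncSet" "HOL-Library.Ramsey"
begin

unbundle cardinal_syntax

text \<open>
  Cardinals are represented as in the BNF cardinal library of \<open>Main\<close>, by cardinal orders
  \<open>\<kappa> :: 'a rel\<close> with \<open>Card_order \<kappa>\<close>, that is, by well-orders of least order type on their field.
  Such a \<open>\<kappa>\<close> is an isomorphic copy of an initial ordinal: its elements are those of
  \<open>Field \<kappa>\<close>, its ordering is \<open>\<kappa>\<close> itself (reflexive), and its finite subsets form
  \<open>Fpow (Field \<kappa>)\<close>.
\<close>

definition is_monochromatic :: "('s \<Rightarrow> nat) \<Rightarrow> 's set \<Rightarrow> bool" where
  "is_monochromatic c T \<longleftrightarrow> (\<exists>k. \<forall>t\<in>T. c t = k)"

definition FU :: "nat set \<Rightarrow> 'a set set \<Rightarrow> 'a set set" where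
  "FU A H = (\<Union>j\<in>A. {\<Union>F | F. F \<in> nsets H j})"

definition maxim :: "'a rel \<Rightarrow> 'a set \<Rightarrow> 'a" where
  "maxim r x = (THE m. m \<in> x \<and> (\<forall>u\<in>x. (u, m) \<in> r))"

definition unmeshed :: "'a rel \<Rightarrow> 'a set \<Rightarrow> 'a set \<Rightarrow> bool" where
  "unmeshed r x y \<longleftrightarrow>
     (maxim r x, wo_rel.minim r y) \<in> r - Id \<or> (maxim r y, wo_rel.minim r x) \<in> r - Id"

definition unmeshed_family :: "'a rel \<Rightarrow> 'a set set \<Rightarrow> bool" where
  "unmeshed_family r H \<longleftrightarrow> H \<subseteq> Fpow (Field r) - {{}} \<and> pairwise (unmeshed r) H"

definition Hindman_Schur_unmeshed :: "'a rel \<Rightarrow> 'b rel \<Rightarrow> bool" where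
  "Hindman_Schur_unmeshed \<kappa> l \<longleftrightarrow>
     (\<forall>c \<in> Fpow (Field \<kappa>) \<rightarrow> {0, 1, 2}.
        \<exists>H a b. unmeshed_family \<kappa> H \<and> |H| =o l \<and> 0 < a \<and> 0 < b \<and>
                is_monochromatic c (FU {a, b, a + b} H))"

text \<open>
  The sets \<open>S\<close> of cardinality \<open>\<kappa>\<close> range over the type that carries \<open>\<kappa>\<close>; since the property is
  invariant under bijections, this covers sets of cardinality \<open>\<kappa>\<close> in every type.
\<close>

definition arrows_pairs :: "'a rel \<Rightarrow> 'b rel \<Rightarrow> bool" where
  "arrows_pairs \<kappa> l \<longleftrightarrow>
     (\<forall>S :: 'a set. |S| =o \<kappa> \<longrightarrow>
        (\<forall>f \<in> nsets S 2 \<rightarrow> {0, 1}. \<exists>X \<subseteq> S. |X| =o l \<and> is_monochromatic f (nsets X 2)))"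

end

theory Submission
  imports Defs
begin

text \<open>
  Let \<open>d\<close> be a colouring of the pairs from \<open>\<kappa>\<close> in two colours and write \<open>\<lambda>\<close> for the cardinal \<open>l\<close>.
  If \<open>\<lambda>\<close> is countable, the infinite Ramsey theorem applies, so let \<open>\<lambda>\<close> be uncountable. The
  argument goes through the Erdos-Rado ramification tree of \<open>d\<close>, whose nodes are the elements of \<open>\<kappa>\<close>:
  \<open>\<gamma>\<close> lies below \<open>\<alpha>\<close> if \<open>\<gamma> < \<alpha>\<close> and \<open>d\<close> sends \<open>{\<delta>, \<gamma>}\<close> and \<open>{\<delta>, \<alpha>}\<close> to the same colour for every
  \<open>\<delta>\<close> below \<open>\<gamma>\<close>. Along a chain of this tree the colour of a pair depends on its smaller element
  only, so a chain of cardinality \<open>\<lambda>\<close> contains a homogeneous set of cardinality \<open>\<lambda>\<close>. It remains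
  to defeat the Hindman-Schur condition when every chain has fewer than \<open>\<lambda>\<close> elements.

  Two incomparable nodes part at exactly one node, one of them turning left and the other right.
  Colour a finite set \<open>x\<close> by the parity of the number of right turns that the branch of \<open>max x\<close>
  takes at the nodes where it parts from other elements of \<open>x\<close>. For regular \<open>\<lambda>\<close> this works: any
  unmeshed family \<open>H\<close> of cardinality \<open>\<lambda>\<close> can be thinned out until some node \<open>\<sigma>\<close> has, on either
  side, \<open>\<lambda>\<close> many members whose maximum passes through that side, and such that taking \<open>h\<close> from one side and
  \<open>n - 1\<close> earlier members from the other side adds to the partings inside \<open>h\<close> just the one at
  \<open>\<sigma>\<close>. Interchanging the sides turns a left turn at \<open>\<sigma>\<close> into a right turn and changes the parity,
  so that \<open>n\<close>-fold unions have both colours for each \<open>n \<ge> 2\<close>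
  (\<open>unions_of_both_parities\<close>).

  For singular \<open>\<lambda>\<close> the field of \<open>\<kappa>\<close> is cut into fewer than \<open>\<lambda>\<close> intervals, each of which embeds
  into a part of the tree where some regular uncountable cardinal not above \<open>\<lambda>\<close> bounds all chains
  strictly. A set inside one interval is coloured by parity through the embedding; the third
  colour marks the sets that meet several intervals. If all \<open>n\<close>-fold unions had the third colour,
  each interval would host only finitely many maxima of members of \<open>H\<close>, which would make \<open>H\<close> too
  small; otherwise all of
  \<open>H\<close> lies in one interval, and the regular case applies there (\<open>not_Hindman_Schur_singular\<close>).
\<close>

section \<open>Cardinality in well-orders\<close>

lemma not_ordLess_card_iff: "Card_order l \<Longrightarrow> \<not> |A| <o l \<longleftrightarrow> l \<le>o |A|"
  using not_ordLess_iff_ordLeq[of l "|A|"] by (simp add: card_order_on_well_order_on card_of_Well_order)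

lemma ordLess_subset: "A \<subseteq> B \<Longrightarrow> |B| <o l \<Longrightarrow> |A| <o l"
  by (rule ordLeq_ordLess_trans[OF card_of_mono1])

lemma ordLess_image: "|A| <o l \<Longrightarrow> |f ` A| <o l"
  by (rule ordLeq_ordLess_trans[OF card_of_image])

lemma ordLess_inj_preimage:
  assumes "inj_on f A" "f ` A \<subseteq> B" "|B| <o l"
  shows "|A| <o l"
proof -
  have "|A| \<le>o |B|" using assms(1,2) card_of_ordLeq[of A B] by blast
  then show ?thesis using assms(3) by (rule ordLeq_ordLess_trans)
qed

lemma ordLess_finite: "Cinfinite l \<Longrightarrow> finite A \<Longrightarrow> |A| <o l"
  using finite_ordLess_infinite[of "|A|" l] card_of_Well_order[of A]
  by (auto simp: cinfinite_def card_order_on_def Field_card_of)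

lemma large_nonempty: "Cinfinite l \<Longrightarrow> \<not> |A| <o l \<Longrightarrow> A \<noteq> {}"
  using ordLess_finite[of l A] by auto

lemma ordLess_Un:
  assumes "Cinfinite l" "|A| <o l" "|B| <o l"
  shows "|A \<union> B| <o l"
  by (rule card_of_Un_ordLess_infinite_Field) (use assms in \<open>auto simp: cinfinite_def\<close>)

lemma ordLess_Diff:
  assumes "Cinfinite l" "\<not> |A| <o l" "|B| <o l"
  shows "\<not> |A - B| <o l"
proof
  assume "|A - B| <o l"
  then have "|(A - B) \<union> B| <o l" using assms by (intro ordLess_Un)
  then have "|A| <o l" by (rule ordLess_subset[rotated]) blast
  then show False using assms(2) by blast
qed

lemmas ordLess_UN = card_of_UNION_ordLess_infinite_Field_regularCard

lemma Cinfinite_card_of: "infinite A \<Longrightarrow> Cinfinite |A|"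
  by (simp add: cinfinite_def Field_card_of card_of_card_order_on)

lemma subset_of_cardinality:
  assumes "Card_order l" "l \<le>o |A|"
  obtains X where "X \<subseteq> A" "|X| =o l"
proof -
  have "|Field l| \<le>o |A|" by (rule ordIso_ordLeq_trans[OF card_of_Field_ordIso[OF assms(1)] assms(2)])
  then obtain f where f: "inj_on f (Field l)" "f ` Field l \<subseteq> A"
    unfolding card_of_ordLeq[symmetric] by blast
  have "|f ` Field l| =o |Field l|"
    by (rule ordIso_symmetric, subst card_of_ordIso[symmetric])
      (use inj_on_imp_bij_betw[OF f(1)] in blast)
  then have "|f ` Field l| =o l" by (rule ordIso_transitive[OF _ card_of_Field_ordIso[OF assms(1)]])
  then show thesis by (rule that[OF f(2)])
qed

lemma underS_ofilter: "Well_order r \<Longrightarrow> wo_rel.ofilter r (underS r a)"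
  by (simp add: wo_rel.underS_ofilter wo_rel_def)

lemma ordLess_card_underS:
  assumes "Well_order r" "Card_order q" "q <o r"
  obtains a where "a \<in> Field r" "q =o |underS r a|"
proof -
  have "Well_order q" using assms(2) by (rule card_order_on_well_order_on)
  then obtain a where a: "a \<in> Field r" "q =o Restr r (underS r a)"
    using assms(3) ordLess_iff_ordIso_Restr[OF assms(1)] by blast
  let ?p = "Restr r (underS r a)"
  have "Card_order ?p" by (rule Card_order_ordIso2[OF assms(2) a(2)])
  moreover have "Field ?p = underS r a"
    by (rule Field_Restr_ofilter[OF assms(1) underS_ofilter[OF assms(1)]])
  ultimately have "|underS r a| =o ?p" using card_of_Field_ordIso by fastforce
  then have "q =o |underS r a|" by (rule ordIso_transitive[OF a(2) ordIso_symmetric])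
  then show thesis using a(1) that by blast
qed

text \<open>
  An initial ordinal is the shortest well-order of its cardinality: if \<open>A\<close> were larger than \<open>q\<close>, then
  \<open>q\<close> would be equinumerous to a proper initial segment of \<open>A\<close>.
\<close>

lemma card_ordLeq_if_small_initial_segments:
  assumes "Well_order r" "A \<subseteq> Field r" "Card_order q"
    and small: "\<And>a. a \<in> A \<Longrightarrow> |underS r a \<inter> A| <o q"
  shows "|A| \<le>o q"
proof (rule ccontr)
  assume "\<not> |A| \<le>o q"
  then have "q <o |A|"
    using not_ordLeq_iff_ordLess[of q "|A|"] card_order_on_well_order_on[OF assms(3)]
    by (simp add: card_of_Well_order)
  moreover have w: "Well_order (Restr r A)" "Field (Restr r A) = A"
    using well_order_on_Well_order[OF well_order_on_Restr[OF assms(1,2)]] by auto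
  ultimately have "q <o Restr r A"
    using card_of_least[of A "Restr r A"] by (auto intro: ordLess_ordLeq_trans)
  then obtain a where a: "a \<in> A" "q =o |underS (Restr r A) a|"
    using ordLess_card_underS[OF w(1) assms(3)] unfolding w(2) by blast
  have "underS (Restr r A) a \<subseteq> underS r a \<inter> A" unfolding underS_def by auto
  then have "|underS (Restr r A) a| <o q" using small[OF a(1)] ordLess_subset by blast
  then show False using not_ordLess_ordIso ordIso_symmetric[OF a(2)] by blast
qed

text \<open>
  Call a set small if its cardinality is below \<open>l\<close>, and large otherwise. A large set may have an
  order type beyond \<open>l\<close>; cutting it off at the first element with a
  large initial segment, if there is one, keeps it large and leaves only small initial segments.
\<close>

lemma large_subset_with_small_initial_segments:
  assumes "Well_order r" "Z \<subseteq> Field r" "\<not> |Z| <o l"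
  obtains Z0 where "Z0 \<subseteq> Z" "\<not> |Z0| <o l" "\<And>a. a \<in> Z0 \<Longrightarrow> |underS r a \<inter> Z0| <o l"
proof -
  define Z0 where "Z0 = {a \<in> Z. |underS r a \<inter> Z| <o l}"
  have wo: "wo_rel r" using assms(1) by (simp add: wo_rel_def)
  let ?m = "wo_rel.minim r (Z - Z0)"
  have "\<not> |Z0| <o l"
  proof
    assume s: "|Z0| <o l"
    then have "Z - Z0 \<noteq> {}" using assms(3) ordLess_subset[of Z Z0 l] by blast
    moreover have sub: "Z - Z0 \<subseteq> Field r" using assms(2) by blast
    ultimately have m: "?m \<in> Z - Z0" "\<And>b. b \<in> Z - Z0 \<Longrightarrow> (?m, b) \<in> r"
      using wo_rel.minim_in[OF wo sub] wo_rel.minim_least[OF wo sub] by blast+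
    have "underS r ?m \<inter> Z \<subseteq> Z0"
    proof
      fix b assume b: "b \<in> underS r ?m \<inter> Z"
      show "b \<in> Z0"
      proof (rule ccontr)
        assume "b \<notin> Z0"
        then have "(?m, b) \<in> r" using b by (intro m(2)) simp
        then show False using b antisymD[OF wo_rel.ANTISYM[OF wo]] by (auto simp: underS_def)
      qed
    qed
    then have "|underS r ?m \<inter> Z| <o l" using s ordLess_subset by blast
    then show False using m(1) unfolding Z0_def by blast
  qed
  moreover have "Z0 \<subseteq> Z" unfolding Z0_def by blast
  moreover have "|underS r a \<inter> Z0| <o l" if "a \<in> Z0" for a
    using that ordLess_subset[of "underS r a \<inter> Z0" "underS r a \<inter> Z"] unfolding Z0_def by blast
  ultimately show thesis using that by blast
qed

section \<open>Trees with turns\<close>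

text \<open>
  A binary tree is given by the set \<open>P \<alpha>\<close> of nodes strictly below \<open>\<alpha>\<close> and, for \<open>\<delta> \<in> P \<alpha>\<close>, by the side
  \<open>t \<delta> \<alpha>\<close> on which the branch to \<open>\<alpha>\<close> leaves \<open>\<delta>\<close>. Incomparable nodes leave some common lower node on
  different sides; by \<open>turn_below\<close> and \<open>below_linear\<close> there is only one such node.
\<close>

locale forking_tree =
  fixes V :: "'a set" and P :: "'a \<Rightarrow> 'a set" and t :: "'a \<Rightarrow> 'a \<Rightarrow> bool"
  assumes below_in: "\<beta> \<in> V \<Longrightarrow> \<alpha> \<in> P \<beta> \<Longrightarrow> \<alpha> \<in> V"
    and below_trans: "\<gamma> \<in> V \<Longrightarrow> \<beta> \<in> P \<gamma> \<Longrightarrow> \<alpha> \<in> P \<beta> \<Longrightarrow> \<alpha> \<in> P \<gamma>"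
    and turn_below: "\<gamma> \<in> V \<Longrightarrow> \<beta> \<in> P \<gamma> \<Longrightarrow> \<alpha> \<in> P \<beta> \<Longrightarrow> t \<alpha> \<beta> = t \<alpha> \<gamma>"
    and below_linear: "\<gamma> \<in> V \<Longrightarrow> \<alpha> \<in> P \<gamma> \<Longrightarrow> \<beta> \<in> P \<gamma> \<Longrightarrow> \<alpha> = \<beta> \<or> \<alpha> \<in> P \<beta> \<or> \<beta> \<in> P \<alpha>"
    and fork: "\<alpha> \<in> V \<Longrightarrow> \<beta> \<in> V \<Longrightarrow> \<alpha> \<noteq> \<beta> \<Longrightarrow>
      \<alpha> \<in> P \<beta> \<or> \<beta> \<in> P \<alpha> \<or> (\<exists>\<delta>\<in>P \<alpha> \<inter> P \<beta>. t \<delta> \<alpha> \<noteq> t \<delta> \<beta>)"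
    and wf_below: "wf {(\<alpha>, \<beta>). \<beta> \<in> V \<and> \<alpha> \<in> P \<beta>}"

definition tree_chain :: "('a \<Rightarrow> 'a set) \<Rightarrow> 'a set \<Rightarrow> bool" where
  "tree_chain P C \<longleftrightarrow> (\<forall>\<alpha>\<in>C. \<forall>\<beta>\<in>C. \<alpha> = \<beta> \<or> \<alpha> \<in> P \<beta> \<or> \<beta> \<in> P \<alpha>)"

text \<open>
  The nodes at which the branch to \<open>z\<close> parts from the branch to some element of \<open>X\<close>, each with
  the side taken by \<open>z\<close>. Recording the side makes containment of a fixed set of pairs in the forks
  of \<open>z\<close> determine how \<open>z\<close> turns at these nodes.
\<close>

definition forks :: "('a \<Rightarrow> 'a set) \<Rightarrow> ('a \<Rightarrow> 'a \<Rightarrow> bool) \<Rightarrow> 'a \<Rightarrow> 'a set \<Rightarrow> ('a \<times> bool) set" where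
  "forks P t z X = {(\<delta>, e). \<delta> \<in> P z \<and> t \<delta> z = e \<and> (\<exists>u\<in>X. \<delta> \<in> P u \<and> t \<delta> u \<noteq> e)}"

definition right_turns :: "('a \<Rightarrow> 'a set) \<Rightarrow> ('a \<Rightarrow> 'a \<Rightarrow> bool) \<Rightarrow> 'a \<Rightarrow> 'a set \<Rightarrow> nat" where
  "right_turns P t z X = card {\<delta>. (\<delta>, True) \<in> forks P t z X}"

context forking_tree
begin

lemma forking_tree_subset:
  assumes "W \<subseteq> V" "\<And>\<alpha> \<beta>. \<beta> \<in> W \<Longrightarrow> \<alpha> \<in> P \<beta> \<Longrightarrow> \<alpha> \<in> W"
  shows "forking_tree W P t"
proof
  show "wf {(\<alpha>, \<beta>). \<beta> \<in> W \<and> \<alpha> \<in> P \<beta>}"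
    by (rule wf_subset[OF wf_below]) (use assms(1) in auto)
  fix \<alpha> \<beta> \<gamma>
  assume "\<gamma> \<in> W"
  then have *: "\<gamma> \<in> V" using assms(1) by blast
  show "\<beta> \<in> P \<gamma> \<Longrightarrow> \<alpha> \<in> P \<beta> \<Longrightarrow> \<alpha> \<in> P \<gamma>" by (rule below_trans[OF *])
  show "\<beta> \<in> P \<gamma> \<Longrightarrow> \<alpha> \<in> P \<beta> \<Longrightarrow> t \<alpha> \<beta> = t \<alpha> \<gamma>" by (rule turn_below[OF *])
  show "\<alpha> \<in> P \<gamma> \<Longrightarrow> \<beta> \<in> P \<gamma> \<Longrightarrow> \<alpha> = \<beta> \<or> \<alpha> \<in> P \<beta> \<or> \<beta> \<in> P \<alpha>"
    by (rule below_linear[OF *])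
next
  fix \<alpha> \<beta>
  assume "\<alpha> \<in> W" "\<beta> \<in> W" "\<alpha> \<noteq> \<beta>"
  then show "\<alpha> \<in> P \<beta> \<or> \<beta> \<in> P \<alpha> \<or> (\<exists>\<delta>\<in>P \<alpha> \<inter> P \<beta>. t \<delta> \<alpha> \<noteq> t \<delta> \<beta>)"
    using fork assms(1) by blast
qed (use assms(2) in blast)

lemma finite_forks:
  assumes "z \<in> V" "finite X" "X \<subseteq> V"
  shows "finite (forks P t z X)"
proof -
  have "forks P t z X = (\<Union>u\<in>X. forks P t z {u})" unfolding forks_def by auto
  moreover have "finite (forks P t z {u})" if "u \<in> X" for u
  proof -
    have "p = q" if pq: "p \<in> forks P t z {u}" "q \<in> forks P t z {u}" for p q
    proof -
      obtain \<delta> \<epsilon> where [simp]: "p = (\<delta>, t \<delta> z)" "q = (\<epsilon>, t \<epsilon> z)"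
        and *: "\<delta> \<in> P z" "\<epsilon> \<in> P z" "\<delta> \<in> P u" "\<epsilon> \<in> P u" "t \<delta> u \<noteq> t \<delta> z" "t \<epsilon> u \<noteq> t \<epsilon> z"
        using pq unfolding forks_def by auto
      have "u \<in> V" using \<open>u \<in> X\<close> assms(3) by blast
      have "\<delta> \<notin> P \<epsilon>"
        using turn_below[OF assms(1) *(2), of \<delta>] turn_below[OF \<open>u \<in> V\<close> *(4), of \<delta>] *(5) by blast
      moreover have "\<epsilon> \<notin> P \<delta>"
        using turn_below[OF assms(1) *(1), of \<epsilon>] turn_below[OF \<open>u \<in> V\<close> *(3), of \<epsilon>] *(6) by blast
      ultimately show ?thesis using below_linear[OF assms(1) *(1,2)] by simp
    qed
    then have "forks P t z {u} = {} \<or> (\<exists>p. forks P t z {u} = {p})" by blast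
    then show ?thesis by auto
  qed
  ultimately show ?thesis using assms(2) by simp
qed

text \<open>
  Assume that each node has at most one large side. The nodes all of whose predecessors
  are left on a large side form a chain \<open>N\<close>, since a parting of two of them would have two large
  sides. Every other \<open>z h\<close> leaves the tree of large sides at a first node, which belongs to \<open>N\<close>, so
  \<open>H\<close> would be covered by fewer than \<open>l\<close> small sets.
\<close>

lemma large_fork:
  fixes l :: "'l rel" and z :: "'h \<Rightarrow> 'a"
  assumes l: "Cinfinite l" "regularCard l"
    and chains: "\<And>C. C \<subseteq> V \<Longrightarrow> tree_chain P C \<Longrightarrow> |C| <o l"
    and z: "z ` H \<subseteq> V" "inj_on z H" and large: "\<not> |H| <o l"
  obtains \<sigma> where "\<sigma> \<in> V" "\<forall>e. \<not> |{h \<in> H. \<sigma> \<in> P (z h) \<and> t \<sigma> (z h) = e}| <o l"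
proof (rule ccontr)
  note witness = that
  assume no_fork: "\<not> thesis"
  define A where "A \<sigma> e = {h \<in> H. \<sigma> \<in> P (z h) \<and> t \<sigma> (z h) = e}" for \<sigma> e
  define N where "N = {\<sigma> \<in> V. \<forall>\<epsilon>\<in>P \<sigma>. \<not> |A \<epsilon> (t \<epsilon> \<sigma>)| <o l}"
  define B where "B \<sigma> = (\<Union>e\<in>{e. |A \<sigma> e| <o l}. A \<sigma> e)" for \<sigma>
  have one_side: "|A \<sigma> True| <o l \<or> |A \<sigma> False| <o l" if "\<sigma> \<in> V" for \<sigma>
  proof (rule ccontr)
    assume "\<not> ?thesis"
    then have "\<forall>e. \<not> |A \<sigma> e| <o l" by (metis (full_types))
    then show False using no_fork witness[OF \<open>\<sigma> \<in> V\<close>] unfolding A_def by blast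
  qed
  have "tree_chain P N"
    unfolding tree_chain_def
  proof (intro ballI)
    fix \<alpha> \<beta> assume ab: "\<alpha> \<in> N" "\<beta> \<in> N"
    show "\<alpha> = \<beta> \<or> \<alpha> \<in> P \<beta> \<or> \<beta> \<in> P \<alpha>"
    proof (rule ccontr)
      assume "\<not> ?thesis"
      then obtain \<delta> where \<delta>: "\<delta> \<in> P \<alpha>" "\<delta> \<in> P \<beta>" "t \<delta> \<alpha> \<noteq> t \<delta> \<beta>"
        using fork[of \<alpha> \<beta>] ab unfolding N_def by blast
      then have "\<not> |A \<delta> (t \<delta> \<alpha>)| <o l" "\<not> |A \<delta> (t \<delta> \<beta>)| <o l"
        using ab unfolding N_def by blast+
      moreover have "\<delta> \<in> V" using ab(1) below_in[of \<alpha> \<delta>] \<delta>(1) unfolding N_def by blast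
      ultimately show False using one_side[of \<delta>] \<delta>(3) by (cases "t \<delta> \<alpha>"; cases "t \<delta> \<beta>") auto
    qed
  qed
  then have N: "|N| <o l" by (rule chains[rotated]) (auto simp: N_def)
  have "|{h \<in> H. z h \<in> N}| <o l"
    by (rule ordLess_inj_preimage[OF _ _ N, of z]) (auto intro: inj_on_subset[OF z(2)])
  moreover have "|B \<sigma>| <o l" for \<sigma>
    unfolding B_def by (rule ordLess_UN[OF l(2,1)]) (auto intro: ordLess_finite[OF l(1)])
  then have "|\<Union>\<sigma>\<in>N. B \<sigma>| <o l" by (intro ordLess_UN[OF l(2,1) N]) blast
  moreover have "H \<subseteq> {h \<in> H. z h \<in> N} \<union> (\<Union>\<sigma>\<in>N. B \<sigma>)"
  proof
    fix h assume h: "h \<in> H"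
    show "h \<in> {h \<in> H. z h \<in> N} \<union> (\<Union>\<sigma>\<in>N. B \<sigma>)"
    proof (cases "z h \<in> N")
      case False
      have zV: "z h \<in> V" using h z by blast
      let ?S = "{\<epsilon> \<in> P (z h). |A \<epsilon> (t \<epsilon> (z h))| <o l}"
      \<comment> \<open>the first node that the branch leaves on a small side\<close>
      obtain \<epsilon> where "\<epsilon> \<in> ?S" using False zV unfolding N_def by blast
      then obtain \<sigma> where \<sigma>: "\<sigma> \<in> ?S" "\<And>\<epsilon>. \<sigma> \<in> V \<Longrightarrow> \<epsilon> \<in> P \<sigma> \<Longrightarrow> \<epsilon> \<notin> ?S"
        by (rule wfE_min[OF wf_below]) blast
      have "\<sigma> \<in> V" using below_in[OF zV] \<sigma>(1) by blast
      have "\<not> |A \<epsilon> (t \<epsilon> \<sigma>)| <o l" if "\<epsilon> \<in> P \<sigma>" for \<epsilon>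
        using \<sigma>(2)[OF \<open>\<sigma> \<in> V\<close> that] below_trans[OF zV _ that] turn_below[OF zV _ that] \<sigma>(1) by simp
      then have "\<sigma> \<in> N" using \<open>\<sigma> \<in> V\<close> unfolding N_def by blast
      moreover have "h \<in> B \<sigma>" using \<sigma>(1) h unfolding B_def by (auto simp: A_def)
      ultimately show ?thesis by blast
    qed (use h in blast)
  qed
  ultimately have "H \<subseteq> {h \<in> H. z h \<in> N} \<union> (\<Union>\<sigma>\<in>N. B \<sigma>)"
    "|{h \<in> H. z h \<in> N} \<union> (\<Union>\<sigma>\<in>N. B \<sigma>)| <o l"
    by (simp_all only: ordLess_Un[OF l(1)])
  then have "|H| <o l" by (rule ordLess_subset)
  then show False using large by blast
qed

text \<open>
  The numbers \<open>card (M h)\<close> of internal forks are first made constant,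
  which bounds the size of sets \<open>F\<close> of forks shared by a large subfamily; for an \<open>F\<close> of
  maximal size any further fork is rare. After discarding the few members with a fork outside \<open>F\<close> at
  or below a node \<open>\<sigma>\<close> with two large sides, every fork of \<open>z h\<close>
  with a set \<open>X g\<close> from the opposite side is either in \<open>F\<close>, hence already internal to \<open>X h\<close>, or the
  new one at \<open>\<sigma>\<close>. Choosing the side of \<open>h\<close> chooses the parity.
\<close>

lemma unions_of_both_parities:
  fixes l :: "'l rel" and z :: "'h \<Rightarrow> 'a"
  assumes l: "Cinfinite l" "regularCard l" "natLeq <o l"
    and chains: "\<And>C. C \<subseteq> V \<Longrightarrow> tree_chain P C \<Longrightarrow> |C| <o l"
    and zV: "\<And>h. h \<in> H \<Longrightarrow> z h \<in> V" and X: "\<And>h. h \<in> H \<Longrightarrow> finite (X h) \<and> X h \<subseteq> V \<and> z h \<in> X h"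
    and inj: "inj_on z H" and large: "\<not> |H| <o l"
    and later: "\<And>h. h \<in> H \<Longrightarrow> |{g \<in> H. \<not> before h g}| <o l"
    and n: "n > 0"
  shows "\<exists>h\<in>H. \<exists>G\<subseteq>H. finite G \<and> card G = n \<and> (\<forall>g\<in>G. before g h) \<and>
    odd (right_turns P t (z h) (X h \<union> \<Union>(X ` G))) = b"
proof -
  define M where "M h = forks P t (z h) (X h)" for h
  \<comment> \<open>one number that codes both the number of forks and the parity of right turns\<close>
  define f where "f h = 2 * card (M h) + of_bool (odd (right_turns P t (z h) (X h)))" for h
  have finM: "finite (M h)" if "h \<in> H" for h
    unfolding M_def using finite_forks zV X that by blast
  have "\<exists>y. \<not> |{h \<in> H. f h = y}| <o l"
  proof (rule ccontr)
    assume "\<not> ?thesis"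
    moreover have "|UNIV :: nat set| <o l" by (rule ordIso_ordLess_trans[OF card_of_nat l(3)])
    ultimately have "|\<Union>y. {h \<in> H. f h = y}| <o l" by (intro ordLess_UN[OF l(2,1)]) auto
    then have "|H| <o l" by (rule ordLess_subset[rotated]) auto
    then show False using large by blast
  qed
  then obtain y where "\<not> |{h \<in> H. f h = y}| <o l" by blast
  moreover define H1 where "H1 = {h \<in> H. f h = y}"
  ultimately have H1: "\<not> |H1| <o l" by simp
  let ?Q = "\<lambda>F. finite F \<and> \<not> |{h \<in> H1. F \<subseteq> M h}| <o l"
  have bound: "card F \<le> y" if "?Q F" for F
  proof -
    have "{h \<in> H1. F \<subseteq> M h} \<noteq> {}" using that large_nonempty[OF l(1)] by blast
    then obtain h where "h \<in> H1" "F \<subseteq> M h" by blast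
    then have "card F \<le> card (M h)" "f h = y" using finM card_mono unfolding H1_def by blast+
    then show ?thesis unfolding f_def by linarith
  qed
  have "?Q {}" using H1 by simp
  moreover have "\<forall>F. ?Q F \<longrightarrow> card F < Suc y" using bound less_Suc_eq_le by blast
  ultimately have "\<exists>F. ?Q F \<and> (\<forall>F'. ?Q F' \<longrightarrow> card F' \<le> card F)"
    by (rule Lattices_Big.ex_has_greatest_nat[of ?Q])
  then obtain F where F: "?Q F" and maxF: "\<And>F'. ?Q F' \<Longrightarrow> card F' \<le> card F"
    by blast
  define H2 where "H2 = {h \<in> H1. F \<subseteq> M h}"
  have sub: "H2 \<subseteq> H" unfolding H2_def H1_def by blast
  have H2: "\<not> |H2| <o l" using F unfolding H2_def by blast
  have rare: "|{h \<in> H2. p \<in> M h}| <o l" if "p \<notin> F" for p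
  proof (rule ccontr)
    assume "\<not> ?thesis"
    moreover have "{h \<in> H2. p \<in> M h} = {h \<in> H1. insert p F \<subseteq> M h}" unfolding H2_def by blast
    ultimately have "card (insert p F) \<le> card F" using maxF[of "insert p F"] F by simp
    then show False using that F by simp
  qed
  have zsub: "z ` H2 \<subseteq> V" using zV sub by blast
  obtain \<sigma> where \<sigma>: "\<sigma> \<in> V" "\<forall>e. \<not> |{h \<in> H2. \<sigma> \<in> P (z h) \<and> t \<sigma> (z h) = e}| <o l"
    by (rule large_fork[OF l(1,2) chains zsub inj_on_subset[OF inj sub] H2]) blast
  define A where "A e = {h \<in> H2. \<sigma> \<in> P (z h) \<and> t \<sigma> (z h) = e}" for e
  have A_ne: "A e \<noteq> {}" for e
    unfolding A_def by (rule large_nonempty[OF l(1) \<sigma>(2)[rule_format]])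
  \<comment> \<open>all members of \<open>H2\<close> turn alike at the nodes of \<open>F\<close>, but not at \<open>\<sigma>\<close>\<close>
  have \<sigma>F: "(\<sigma>, e) \<notin> F" for e
  proof
    assume "(\<sigma>, e) \<in> F"
    then have "t \<sigma> (z h) = e" if "h \<in> H2" for h
      using that unfolding H2_def M_def forks_def by auto
    moreover obtain h where "h \<in> A (\<not> e)" using A_ne by blast
    ultimately show False unfolding A_def by auto
  qed
  \<comment> \<open>the members with a fork outside \<open>F\<close> at or below \<open>\<sigma>\<close>; few, as \<open>\<sigma>\<close> and its predecessors form a chain\<close>
  define R where "R = (\<Union>\<delta>\<in>insert \<sigma> (P \<sigma>). \<Union>e\<in>{e. (\<delta>, e) \<notin> F}. {h \<in> H2. (\<delta>, e) \<in> M h})"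
  have "|R| <o l"
    unfolding R_def
  proof (intro ordLess_UN[OF l(2,1)] ballI)
    have "tree_chain P (insert \<sigma> (P \<sigma>))"
      using below_linear[OF \<sigma>(1)] unfolding tree_chain_def by auto
    then show "|insert \<sigma> (P \<sigma>)| <o l"
      by (rule chains[rotated]) (use \<sigma>(1) below_in in blast)
  qed (auto intro: rare ordLess_finite[OF l(1)])
  then have AR: "\<not> |A e - R| <o l" for e
    by (rule ordLess_Diff[OF l(1) \<sigma>(2)[rule_format, of e, folded A_def]])
  have low: "(\<delta>, e) \<in> F" if "h \<in> A e' - R" "\<delta> \<in> insert \<sigma> (P \<sigma>)" "(\<delta>, e) \<in> M h" for h e e' \<delta>
    using that unfolding R_def A_def by blast
  have key: "forks P t (z h) (X h \<union> \<Union>(X ` G)) = insert (\<sigma>, e) (M h)" and new: "(\<sigma>, e) \<notin> M h"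
    if h: "h \<in> A e - R" and G: "G \<subseteq> A (\<not> e) - R" "G \<noteq> {}" for h G e
  proof -
    have AH: "A e' \<subseteq> H" for e' using sub unfolding A_def by blast
    have zh: "z h \<in> V" "\<sigma> \<in> P (z h)" "t \<sigma> (z h) = e" using h AH zV unfolding A_def by auto
    have mem: "p \<in> insert (\<sigma>, e) (M h)"
      if g: "g \<in> G" and u: "u \<in> X g" and p: "p \<in> forks P t (z h) {u}" for p g u
    proof -
      obtain \<delta> where [simp]: "p = (\<delta>, t \<delta> (z h))"
        and \<delta>: "\<delta> \<in> P (z h)" "\<delta> \<in> P u" "t \<delta> u \<noteq> t \<delta> (z h)"
        using p unfolding forks_def by auto
      have gA: "g \<in> A (\<not> e) - R" using g G by blast
      then have zg: "z g \<in> V" "\<sigma> \<in> P (z g)" "t \<sigma> (z g) \<noteq> e"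
        using AH zV unfolding A_def by auto
      have uV: "u \<in> V" using u gA AH X by blast
      consider "\<delta> = \<sigma>" | "\<sigma> \<in> P \<delta>" | "\<delta> \<in> P \<sigma>"
        using below_linear[OF zh(1) \<delta>(1) zh(2)] by blast
      then show ?thesis
      proof cases
        case 1
        then show ?thesis using zh(3) by simp
      next
        case 2
        \<comment> \<open>then \<open>u\<close> is on the side of \<open>h\<close>, so \<open>g\<close> has an internal fork at \<open>\<sigma>\<close>, excluded by \<open>R\<close>\<close>
        have "\<sigma> \<in> P u" using below_trans[OF uV \<delta>(2) 2] .
        moreover have "t \<sigma> u = e"
          using turn_below[OF uV \<delta>(2) 2] turn_below[OF zh(1) \<delta>(1) 2] zh(3) by simp
        ultimately have "(\<sigma>, t \<sigma> (z g)) \<in> M g" using zg u unfolding M_def forks_def by auto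
        then show ?thesis using low[OF gA] \<sigma>F by blast
      next
        case 3
        \<comment> \<open>below \<open>\<sigma>\<close> the branches of \<open>g\<close> and \<open>h\<close> agree, so this is an internal fork of \<open>g\<close>, hence in \<open>F\<close>\<close>
        have "\<delta> \<in> P (z g)" using below_trans[OF zg(1,2) 3] .
        moreover have eq: "t \<delta> (z g) = t \<delta> (z h)"
          using turn_below[OF zg(1,2) 3] turn_below[OF zh(1,2) 3] by simp
        ultimately have "(\<delta>, t \<delta> (z h)) \<in> M g" using \<delta> u unfolding M_def forks_def by auto
        then have "(\<delta>, t \<delta> (z h)) \<in> F" using low[OF gA] 3 by blast
        then show ?thesis using h unfolding A_def H2_def by auto
      qed
    qed
    have "forks P t (z h) (X h \<union> \<Union>(X ` G)) = M h \<union> (\<Union>g\<in>G. \<Union>u\<in>X g. forks P t (z h) {u})"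
      unfolding M_def forks_def by auto
    also have "\<dots> \<subseteq> insert (\<sigma>, e) (M h)" using mem by blast
    finally have "forks P t (z h) (X h \<union> \<Union>(X ` G)) \<subseteq> insert (\<sigma>, e) (M h)" .
    moreover have "(\<sigma>, e) \<in> forks P t (z h) (X h \<union> \<Union>(X ` G))"
    proof -
      obtain g where g: "g \<in> G" using G by blast
      then have "g \<in> A (\<not> e)" using G by blast
      then have "\<sigma> \<in> P (z g)" "t \<sigma> (z g) \<noteq> e" "z g \<in> X g" using AH X unfolding A_def by auto
      then show ?thesis using zh g unfolding forks_def by auto
    qed
    moreover have "M h \<subseteq> forks P t (z h) (X h \<union> \<Union>(X ` G))" unfolding M_def forks_def by auto
    ultimately show "forks P t (z h) (X h \<union> \<Union>(X ` G)) = insert (\<sigma>, e) (M h)" by blast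
    show "(\<sigma>, e) \<notin> M h" using low[OF h] \<sigma>F by blast
  qed
  have parity: "odd (right_turns P t (z h) (X h)) = odd y" if "h \<in> H1" for h
  proof -
    have "f h = y" using that unfolding H1_def by blast
    then show ?thesis unfolding f_def by (cases "odd (right_turns P t (z h) (X h))") auto
  qed
  \<comment> \<open>the internal parity is that of \<open>y\<close>; \<open>h\<close> must turn right at \<open>\<sigma>\<close> exactly if it has to be changed\<close>
  define e where "e = (b \<noteq> odd y)"
  have "infinite (A (\<not> e) - R)" using AR[of "\<not> e"] ordLess_finite[OF l(1), of "A (\<not> e) - R"] by argo
  then obtain G where G: "G \<subseteq> A (\<not> e) - R" "finite G" "card G = n"
    using infinite_arbitrarily_large by blast
  then have GH: "G \<subseteq> H" "G \<noteq> {}" using sub n unfolding A_def by auto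
  have "|\<Union>g\<in>G. {h \<in> H. \<not> before g h}| <o l"
    using later GH(1) by (intro ordLess_UN[OF l(2,1)] ordLess_finite[OF l(1) G(2)]) blast
  then have "\<not> |A e - R - (\<Union>g\<in>G. {h \<in> H. \<not> before g h})| <o l"
    by (rule ordLess_Diff[OF l(1) AR])
  then have "A e - R - (\<Union>g\<in>G. {h \<in> H. \<not> before g h}) \<noteq> {}"
    by (rule large_nonempty[OF l(1)])
  then obtain h where h: "h \<in> A e - R" and after: "\<And>g. g \<in> G \<Longrightarrow> h \<in> H \<Longrightarrow> before g h" by blast
  have hH: "h \<in> H1" "h \<in> H" using h sub unfolding A_def H2_def by auto
  have "odd (right_turns P t (z h) (X h \<union> \<Union>(X ` G))) = b"
  proof (cases e)
    case True
    have "{\<delta>. (\<delta>, True) \<in> insert (\<sigma>, e) (M h)} = insert \<sigma> {\<delta>. (\<delta>, True) \<in> M h}" using True by auto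
    moreover have "finite {\<delta>. (\<delta>, True) \<in> M h}"
      using finite_imageI[OF finM[OF hH(2)], of fst] by (rule rev_finite_subset) force
    ultimately have "right_turns P t (z h) (X h \<union> \<Union>(X ` G)) = Suc (right_turns P t (z h) (X h))"
      using new[OF h G(1) GH(2)] True unfolding right_turns_def key[OF h G(1) GH(2)] M_def[symmetric]
      by simp
    then show ?thesis using parity[OF hH(1)] True unfolding e_def by simp
  next
    case False
    then have "right_turns P t (z h) (X h \<union> \<Union>(X ` G)) = right_turns P t (z h) (X h)"
      unfolding right_turns_def key[OF h G(1) GH(2)] M_def[symmetric] by simp
    then show ?thesis using parity[OF hH(1)] False unfolding e_def by simp
  qed
  then show ?thesis using hH(2) GH(1) G after by blast
qed

text \<open>
  By \<open>turn_below\<close>, all elements of a chain above \<open>\<alpha>\<close> leave \<open>\<alpha>\<close> on the same side, so the chain splits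
  into the elements left to the left and those left to the right.
\<close>

lemma homogeneous_subset_of_large_chain:
  fixes l :: "'l rel"
  assumes l: "Cinfinite l" and C: "C \<subseteq> V" "tree_chain P C" "\<not> |C| <o l"
  obtains X b where "X \<subseteq> C" "|X| =o l" "\<And>\<alpha> \<beta>. \<alpha> \<in> X \<Longrightarrow> \<beta> \<in> X \<Longrightarrow> \<alpha> \<in> P \<beta> \<Longrightarrow> t \<alpha> \<beta> = b"
proof -
  define D where "D b = {\<alpha> \<in> C. \<forall>\<beta>\<in>C. \<alpha> \<in> P \<beta> \<longrightarrow> t \<alpha> \<beta> = b}" for b
  have "C \<subseteq> D True \<union> D False"
  proof
    fix \<alpha> assume \<alpha>: "\<alpha> \<in> C"
    have agree: "t \<alpha> \<beta> = t \<alpha> \<gamma>" if *: "\<beta> \<in> C" "\<gamma> \<in> C" "\<alpha> \<in> P \<beta>" "\<alpha> \<in> P \<gamma>" for \<beta> \<gamma>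
    proof -
      have "\<beta> = \<gamma> \<or> \<beta> \<in> P \<gamma> \<or> \<gamma> \<in> P \<beta>" using C(2) *(1,2) unfolding tree_chain_def by simp
      then show ?thesis
      proof (elim disjE)
        assume "\<beta> \<in> P \<gamma>"
        moreover have "\<gamma> \<in> V" using *(2) C(1) by blast
        ultimately show ?thesis using turn_below *(3) by blast
      next
        assume "\<gamma> \<in> P \<beta>"
        moreover have "\<beta> \<in> V" using *(1) C(1) by blast
        ultimately show ?thesis using turn_below *(4) by blast
      qed simp
    qed
    have "\<exists>b. \<forall>\<beta>\<in>C. \<alpha> \<in> P \<beta> \<longrightarrow> t \<alpha> \<beta> = b"
    proof (cases "\<exists>\<gamma>\<in>C. \<alpha> \<in> P \<gamma>")
      case True
      then obtain \<gamma> where \<gamma>: "\<gamma> \<in> C" "\<alpha> \<in> P \<gamma>" by blast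
      have "\<forall>\<beta>\<in>C. \<alpha> \<in> P \<beta> \<longrightarrow> t \<alpha> \<beta> = t \<alpha> \<gamma>"
        by (intro ballI impI) (rule agree[OF _ \<gamma>(1) _ \<gamma>(2)])
      then show ?thesis ..
    qed simp
    then obtain b where "\<forall>\<beta>\<in>C. \<alpha> \<in> P \<beta> \<longrightarrow> t \<alpha> \<beta> = b" ..
    then show "\<alpha> \<in> D True \<union> D False" using \<alpha> unfolding D_def by (cases b) simp_all
  qed
  then have cover: "C \<subseteq> D True \<union> D False" .
  have "\<exists>b. \<not> |D b| <o l"
  proof (rule ccontr)
    assume "\<not> ?thesis"
    then have *: "|D b| <o l" for b by simp
    have "|C| <o l" by (rule ordLess_subset[OF cover]) (rule ordLess_Un[OF l * *])
    then show False using C(3) by simp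
  qed
  then obtain b where "\<not> |D b| <o l" ..
  then have "l \<le>o |D b|" using not_ordLess_card_iff[of l "D b"] l by simp
  then obtain X where X: "X \<subseteq> D b" "|X| =o l"
    by (rule subset_of_cardinality[OF conjunct2[OF l]])
  show thesis
  proof (rule that)
    show "X \<subseteq> C" using X(1) unfolding D_def by blast
    show "|X| =o l" by (rule X(2))
    show "t \<alpha> \<beta> = b" if "\<alpha> \<in> X" "\<beta> \<in> X" "\<alpha> \<in> P \<beta>" for \<alpha> \<beta>
      using X(1) that unfolding D_def by blast
  qed
qed

end

section \<open>The ramification tree of a pair colouring\<close>

text \<open>
  The Erdos-Rado ramification tree: \<open>ramification R t \<alpha>\<close> collects the end-homogeneous predecessors of
  \<open>\<alpha>\<close>, by recursion along \<open>R\<close>.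
\<close>

definition ramification :: "'a rel \<Rightarrow> ('a \<Rightarrow> 'a \<Rightarrow> bool) \<Rightarrow> 'a \<Rightarrow> 'a set" where
  "ramification R t = wfrec R (\<lambda>P \<alpha>. {\<gamma>. (\<gamma>, \<alpha>) \<in> R \<and> (\<forall>\<delta>\<in>P \<gamma>. t \<delta> \<gamma> = t \<delta> \<alpha>)})"

lemma ramification_iff:
  assumes "wf R"
  shows "\<gamma> \<in> ramification R t \<alpha> \<longleftrightarrow> (\<gamma>, \<alpha>) \<in> R \<and> (\<forall>\<delta>\<in>ramification R t \<gamma>. t \<delta> \<gamma> = t \<delta> \<alpha>)"
proof -
  have "ramification R t \<alpha> =
      {\<gamma>. (\<gamma>, \<alpha>) \<in> R \<and> (\<forall>\<delta>\<in>cut (ramification R t) R \<alpha> \<gamma>. t \<delta> \<gamma> = t \<delta> \<alpha>)}"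
    unfolding ramification_def by (subst wfrec[OF assms]) simp
  then show ?thesis by (auto simp: cut_apply)
qed

lemma forking_tree_ramification:
  assumes "Well_order r"
  shows "forking_tree (Field r) (ramification (r - Id) t) t"
proof -
  let ?R = "r - Id" and ?P = "ramification (r - Id) t"
  have wf: "wf ?R" and tr: "trans r" and as: "antisym r" and tot: "Total r"
    using assms by (auto simp: order_on_defs)
  note iff = ramification_iff[OF wf, of _ t]
  have R_trans: "(\<alpha>, \<gamma>) \<in> ?R" if "(\<alpha>, \<beta>) \<in> ?R" "(\<beta>, \<gamma>) \<in> ?R" for \<alpha> \<beta> \<gamma>
    using that transD[OF tr, of \<alpha> \<beta> \<gamma>] antisymD[OF as, of \<alpha> \<beta>] by auto
  have lower: "(\<alpha>, \<beta>) \<in> ?R" if "\<alpha> \<in> ?P \<beta>" for \<alpha> \<beta>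
    using that iff by blast
  have turn: "t \<alpha> \<beta> = t \<alpha> \<gamma>" if "\<beta> \<in> ?P \<gamma>" "\<alpha> \<in> ?P \<beta>" for \<alpha> \<beta> \<gamma>
    using that iff by blast
  have trans: "\<alpha> \<in> ?P \<gamma>" if "\<beta> \<in> ?P \<gamma>" "\<alpha> \<in> ?P \<beta>" for \<alpha> \<beta> \<gamma>
    using that
  proof (induction \<gamma> arbitrary: \<alpha> \<beta> rule: wf_induct_rule[OF wf])
    case (1 \<gamma>)
    have "t \<delta> \<alpha> = t \<delta> \<gamma>" if \<delta>: "\<delta> \<in> ?P \<alpha>" for \<delta>
      using 1(1)[OF lower[OF 1(2)] 1(3) \<delta>] turn[OF 1(3) \<delta>] turn[OF 1(2), of \<delta>] by simp
    then show ?case using iff R_trans[OF lower[OF 1(3)] lower[OF 1(2)]] by blast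
  qed
  have linear: "\<alpha> \<in> ?P \<beta>" if "\<beta> \<in> ?P \<gamma>" "\<alpha> \<in> ?P \<gamma>" "(\<alpha>, \<beta>) \<in> ?R" for \<alpha> \<beta> \<gamma>
    using that(2,3)
    supply \<beta>\<gamma> = that(1)
  proof (induction \<alpha> rule: wf_induct_rule[OF wf])
    case (1 \<alpha>)
    have "t \<delta> \<alpha> = t \<delta> \<beta>" if \<delta>: "\<delta> \<in> ?P \<alpha>" for \<delta>
    proof -
      have "\<delta> \<in> ?P \<beta>"
        by (rule 1(1)[OF lower[OF \<delta>] trans[OF 1(2) \<delta>] R_trans[OF lower[OF \<delta>] 1(3)]])
      then show ?thesis using turn[OF \<beta>\<gamma>, of \<delta>] turn[OF 1(2) \<delta>] by simp
    qed
    then show ?case using iff 1(3) by blast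
  qed
  \<comment> \<open>the first disagreement below \<open>\<alpha>\<close> is a predecessor of \<open>\<beta>\<close>, because everything below it agrees\<close>
  have fork: "\<alpha> \<in> ?P \<beta> \<or> (\<exists>\<delta>\<in>?P \<alpha> \<inter> ?P \<beta>. t \<delta> \<alpha> \<noteq> t \<delta> \<beta>)" if ab: "(\<alpha>, \<beta>) \<in> ?R" for \<alpha> \<beta>
  proof (cases "\<alpha> \<in> ?P \<beta>")
    case False
    let ?S = "{\<delta> \<in> ?P \<alpha>. t \<delta> \<alpha> \<noteq> t \<delta> \<beta>}"
    obtain \<epsilon> where "\<epsilon> \<in> ?S" using False iff ab by blast
    then obtain \<delta> where \<delta>: "\<delta> \<in> ?S" "\<And>\<epsilon>. (\<epsilon>, \<delta>) \<in> ?R \<Longrightarrow> \<epsilon> \<notin> ?S"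
      by (rule wfE_min[OF wf]) blast
    have "t \<epsilon> \<delta> = t \<epsilon> \<beta>" if \<epsilon>: "\<epsilon> \<in> ?P \<delta>" for \<epsilon>
      using \<delta>(2)[OF lower[OF \<epsilon>]] \<delta>(1) trans[OF _ \<epsilon>, of \<alpha>] turn[OF _ \<epsilon>, of \<alpha>] by auto
    moreover have "(\<delta>, \<beta>) \<in> ?R" using \<delta>(1) by (intro R_trans[OF lower ab]) simp
    ultimately have "\<delta> \<in> ?P \<beta>" using iff by blast
    then show ?thesis using \<delta>(1) by blast
  qed simp
  have total: "(\<alpha>, \<beta>) \<in> ?R \<or> (\<beta>, \<alpha>) \<in> ?R" if "\<alpha> \<in> Field r" "\<beta> \<in> Field r" "\<alpha> \<noteq> \<beta>" for \<alpha> \<beta>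
    using tot that unfolding total_on_def by blast
  show ?thesis
  proof
    fix \<alpha> \<beta> \<gamma>
    show "\<beta> \<in> ?P \<gamma> \<Longrightarrow> \<alpha> \<in> ?P \<beta> \<Longrightarrow> \<alpha> \<in> ?P \<gamma>" by (rule trans)
    show "\<beta> \<in> ?P \<gamma> \<Longrightarrow> \<alpha> \<in> ?P \<beta> \<Longrightarrow> t \<alpha> \<beta> = t \<alpha> \<gamma>" by (rule turn)
    show "\<alpha> \<in> Field r" if "\<alpha> \<in> ?P \<beta>" using lower[OF that] by (auto intro: FieldI1)
    show "\<alpha> = \<beta> \<or> \<alpha> \<in> ?P \<beta> \<or> \<beta> \<in> ?P \<alpha>" if "\<alpha> \<in> ?P \<gamma>" "\<beta> \<in> ?P \<gamma>"
    proof (cases "\<alpha> = \<beta>")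
      case False
      have "\<alpha> \<in> Field r" "\<beta> \<in> Field r"
        using lower[OF that(1)] lower[OF that(2)] by (auto intro: FieldI1)
      then have "(\<alpha>, \<beta>) \<in> ?R \<or> (\<beta>, \<alpha>) \<in> ?R" using total False by simp
      then show ?thesis using linear[OF that(2,1)] linear[OF that] by (elim disjE) simp_all
    qed simp
  next
    fix \<alpha> \<beta> assume "\<alpha> \<in> Field r" "\<beta> \<in> Field r" "\<alpha> \<noteq> \<beta>"
    then consider "(\<alpha>, \<beta>) \<in> ?R" | "(\<beta>, \<alpha>) \<in> ?R" using total by blast
    then show "\<alpha> \<in> ?P \<beta> \<or> \<beta> \<in> ?P \<alpha> \<or> (\<exists>\<delta>\<in>?P \<alpha> \<inter> ?P \<beta>. t \<delta> \<alpha> \<noteq> t \<delta> \<beta>)"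
    proof cases
      case 1
      then show ?thesis using fork[OF 1] by blast
    next
      case 2
      have "\<beta> \<in> ?P \<alpha> \<or> (\<exists>\<delta>\<in>?P \<beta> \<inter> ?P \<alpha>. t \<delta> \<beta> \<noteq> t \<delta> \<alpha>)" by (rule fork[OF 2])
      then show ?thesis by (elim disjE) (blast, force)
    qed
  next
    show "wf {(\<alpha>, \<beta>). \<beta> \<in> Field r \<and> \<alpha> \<in> ?P \<beta>}"
      by (rule wf_subset[OF wf], safe) (drule lower, simp)+
  qed
qed

section \<open>Unmeshed families\<close>

definition all_below :: "'a rel \<Rightarrow> 'a set \<Rightarrow> 'a set \<Rightarrow> bool" where
  "all_below r g h \<longleftrightarrow> (\<forall>u\<in>g. \<forall>v\<in>h. (u, v) \<in> r - Id)"

context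
  fixes r :: "'a rel"
  assumes wo: "Well_order r"
begin

lemma strict_trans: "(a, b) \<in> r \<Longrightarrow> (b, c) \<in> r - Id \<Longrightarrow> (a, c) \<in> r - Id"
  and strict_trans2: "(a, b) \<in> r - Id \<Longrightarrow> (b, c) \<in> r \<Longrightarrow> (a, c) \<in> r - Id"
  and strict_asym: "(a, b) \<in> r - Id \<Longrightarrow> (b, a) \<notin> r"
proof -
  have tr: "trans r" and as: "antisym r" using wo by (auto simp: order_on_defs)
  show "(a, b) \<in> r \<Longrightarrow> (b, c) \<in> r - Id \<Longrightarrow> (a, c) \<in> r - Id"
    using transD[OF tr, of a b c] antisymD[OF as, of b c] by auto
  show "(a, b) \<in> r - Id \<Longrightarrow> (b, c) \<in> r \<Longrightarrow> (a, c) \<in> r - Id"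
    using transD[OF tr, of a b c] antisymD[OF as, of a b] by auto
  show "(a, b) \<in> r - Id \<Longrightarrow> (b, a) \<notin> r"
    using antisymD[OF as, of a b] by auto
qed

lemma maxim_eqI:
  assumes "m \<in> x" "\<And>u. u \<in> x \<Longrightarrow> (u, m) \<in> r"
  shows "maxim r x = m"
proof -
  have as: "antisym r" using wo by (auto simp: order_on_defs)
  show ?thesis
    unfolding maxim_def by (rule the_equality) (use assms antisymD[OF as] in blast)+
qed

lemma maxim_greatest:
  assumes "finite x" "x \<noteq> {}" "x \<subseteq> Field r"
  shows "maxim r x \<in> x" "\<And>u. u \<in> x \<Longrightarrow> (u, maxim r x) \<in> r"
proof -
  have refl: "Refl r" and tot: "Total r" and tr: "trans r"
    using wo by (auto simp: order_on_defs)
  have "\<exists>m\<in>x. \<forall>u\<in>x. (u, m) \<in> r"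
    using assms
  proof (induction x rule: finite_ne_induct)
    case (singleton a)
    then show ?case using refl by (auto simp: refl_on_def)
  next
    case (insert a x)
    then obtain m where m: "m \<in> x" "\<forall>u\<in>x. (u, m) \<in> r" by auto
    have "(a, a) \<in> r" using refl insert.prems by (auto simp: refl_on_def)
    have "m \<noteq> a" using m(1) insert.hyps by blast
    then have "(a, m) \<in> r \<or> (m, a) \<in> r" using tot m(1) insert.prems by (auto simp: total_on_def)
    then show ?case
    proof
      assume "(a, m) \<in> r"
      then show ?thesis using m by blast
    next
      assume ma: "(m, a) \<in> r"
      have "\<forall>u\<in>insert a x. (u, a) \<in> r"
        using \<open>(a, a) \<in> r\<close> m(2) transD[OF tr _ ma] by blast
      then show ?thesis by blast
    qed
  qed
  then obtain m where m: "m \<in> x" "\<forall>u\<in>x. (u, m) \<in> r" by blast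
  have "maxim r x = m" by (rule maxim_eqI[OF m(1)]) (use m(2) in blast)
  then show "maxim r x \<in> x" "\<And>u. u \<in> x \<Longrightarrow> (u, maxim r x) \<in> r" using m by auto
qed

lemma unmeshed_all_below:
  assumes g: "finite g" "g \<noteq> {}" "g \<subseteq> Field r" and h: "finite h" "h \<noteq> {}" "h \<subseteq> Field r"
    and "unmeshed r g h"
  shows "all_below r g h \<or> all_below r h g"
proof -
  have w: "wo_rel r" using wo by (simp add: wo_rel_def)
  have *: "all_below r x y"
    if "finite x" "x \<noteq> {}" "x \<subseteq> Field r" "y \<subseteq> Field r" "(maxim r x, wo_rel.minim r y) \<in> r - Id" for x y
    unfolding all_below_def
  proof (intro ballI)
    fix u v assume "u \<in> x" "v \<in> y"
    then have "(u, maxim r x) \<in> r" "(wo_rel.minim r y, v) \<in> r"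
      using maxim_greatest(2)[OF that(1-3)] wo_rel.minim_least[OF w that(4)] by blast+
    then show "(u, v) \<in> r - Id" using strict_trans strict_trans2 that(5) by blast
  qed
  show ?thesis using *[OF g h(3)] *[OF h g(3)] assms(7) unfolding unmeshed_def by blast
qed

context
  fixes H :: "'a set set"
  assumes H: "unmeshed_family r H"
begin

lemma unmeshed_member:
  assumes "h \<in> H"
  shows "finite h" "h \<noteq> {}" "h \<subseteq> Field r" "maxim r h \<in> h" "\<And>u. u \<in> h \<Longrightarrow> (u, maxim r h) \<in> r"
proof -
  show *: "finite h" "h \<noteq> {}" "h \<subseteq> Field r"
    using H assms unfolding unmeshed_family_def Fpow_def by blast+
  show "maxim r h \<in> h" "\<And>u. u \<in> h \<Longrightarrow> (u, maxim r h) \<in> r" by (fact maxim_greatest[OF *])+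
qed

lemma unmeshed_cases:
  assumes "g \<in> H" "h \<in> H" "g \<noteq> h"
  shows "all_below r g h \<or> all_below r h g"
proof -
  have "unmeshed r g h" using H assms unfolding unmeshed_family_def pairwise_def by blast
  then show ?thesis
    by (rule unmeshed_all_below[OF unmeshed_member(1-3)[OF assms(1)] unmeshed_member(1-3)[OF assms(2)]])
qed

text \<open>
  Comparing maxima orders an unmeshed family, and it thereby inherits the well-order of \<open>r\<close>.
\<close>

lemma all_below_iff_maxim:
  assumes "g \<in> H" "h \<in> H"
  shows "all_below r g h \<longleftrightarrow> (maxim r g, maxim r h) \<in> r - Id"
proof
  assume "all_below r g h"
  then show "(maxim r g, maxim r h) \<in> r - Id"
    using unmeshed_member(4) assms unfolding all_below_def by blast
next
  assume *: "(maxim r g, maxim r h) \<in> r - Id"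
  then have "g \<noteq> h" by blast
  moreover have "\<not> all_below r h g"
  proof
    assume "all_below r h g"
    then have "(maxim r h, maxim r g) \<in> r - Id"
      using unmeshed_member(4) assms unfolding all_below_def by blast
    then show False using strict_asym[OF *] by blast
  qed
  ultimately show "all_below r g h" using unmeshed_cases assms by blast
qed

lemma maxim_linear:
  assumes "g \<in> H" "h \<in> H" "g \<noteq> h"
  shows "all_below r g h \<or> (maxim r h, maxim r g) \<in> r - Id"
  using unmeshed_cases[OF assms] all_below_iff_maxim assms by blast

lemma inj_on_maxim: "inj_on (maxim r) H"
proof (rule inj_onI, rule ccontr)
  fix g h assume gh: "g \<in> H" "h \<in> H" "maxim r g = maxim r h" "g \<noteq> h"
  then show False using maxim_linear[OF gh(1,2,4)] all_below_iff_maxim[OF gh(1,2)] by simp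
qed

lemma maxim_Union:
  assumes "h \<in> H" "G \<subseteq> H" "\<And>g. g \<in> G \<Longrightarrow> all_below r g h"
  shows "maxim r (h \<union> \<Union>G) = maxim r h"
proof (rule maxim_eqI)
  show "maxim r h \<in> h \<union> \<Union>G" using unmeshed_member(4)[OF assms(1)] by blast
  fix u assume "u \<in> h \<union> \<Union>G"
  then show "(u, maxim r h) \<in> r"
    using unmeshed_member(4,5)[OF assms(1)] assms(3) unfolding all_below_def by blast
qed

text \<open>
  The map \<open>p\<close> carries \<open>\<Union>H\<close> into the tree. For singular cardinals it is an arbitrary embedding of an
  interval and destroys the order, so the maximum is taken with respect to \<open>r\<close> before \<open>p\<close> is applied.
\<close>

lemma unmeshed_unions_of_both_parities:
  fixes l :: "'l rel" and p :: "'a \<Rightarrow> 'v"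
  assumes l: "Cinfinite l" "regularCard l" "natLeq <o l"
    and tree: "forking_tree W P t"
    and chains: "\<And>C. C \<subseteq> W \<Longrightarrow> tree_chain P C \<Longrightarrow> |C| <o l"
    and large: "\<not> |H| <o l" and p: "inj_on p (\<Union>H)" "p ` \<Union>H \<subseteq> W" and n: "n \<ge> 2"
  obtains F where "F \<in> nsets H n" "odd (right_turns P t (p (maxim r (\<Union>F))) (p ` \<Union>F)) = b"
proof -
  have "\<not> |maxim r ` H| <o l"
    using large ordLess_inj_preimage[OF inj_on_maxim order_refl] by blast
  moreover have "maxim r ` H \<subseteq> Field r" using unmeshed_member(3,4) by blast
  ultimately obtain Z where Z: "Z \<subseteq> maxim r ` H" "\<not> |Z| <o l"
    "\<And>a. a \<in> Z \<Longrightarrow> |underS r a \<inter> Z| <o l"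
    using large_subset_with_small_initial_segments[OF wo] by metis
  define H0 where "H0 = {h \<in> H. maxim r h \<in> Z}"
  have sub: "H0 \<subseteq> H" unfolding H0_def by blast
  have "Z = maxim r ` H0" using Z(1) unfolding H0_def by blast
  then have large0: "\<not> |H0| <o l" using Z(2) ordLess_image[of H0 l "maxim r"] by argo
  have later: "|{g \<in> H0. \<not> all_below r h g}| <o l" if h: "h \<in> H0" for h
  proof (rule ordLess_inj_preimage[where f = "maxim r"
        and B = "{maxim r h} \<union> (underS r (maxim r h) \<inter> Z)"])
    show "inj_on (maxim r) {g \<in> H0. \<not> all_below r h g}"
      by (rule inj_on_subset[OF inj_on_maxim]) (use sub in blast)
    show "maxim r ` {g \<in> H0. \<not> all_below r h g} \<subseteq> {maxim r h} \<union> (underS r (maxim r h) \<inter> Z)"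
    proof
      fix a assume "a \<in> maxim r ` {g \<in> H0. \<not> all_below r h g}"
      then obtain g where g: "a = maxim r g" "g \<in> H0" "\<not> all_below r h g" by blast
      have "g = h \<or> (maxim r g, maxim r h) \<in> r - Id" using maxim_linear[of h g] g h sub by blast
      then show "a \<in> {maxim r h} \<union> (underS r (maxim r h) \<inter> Z)"
        using g(1,2) unfolding underS_def H0_def by auto
    qed
    show "|{maxim r h} \<union> (underS r (maxim r h) \<inter> Z)| <o l"
      by (intro ordLess_Un[OF l(1)] ordLess_finite[OF l(1)] Z(3)) (use h in \<open>simp_all add: H0_def\<close>)
  qed
  have inj: "inj_on (p \<circ> maxim r) H0"
  proof (rule comp_inj_on)
    show "inj_on (maxim r) H0" by (rule inj_on_subset[OF inj_on_maxim sub])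
    show "inj_on p (maxim r ` H0)"
      by (rule inj_on_subset[OF p(1)]) (use unmeshed_member(4) sub in blast)
  qed
  have tops: "(p \<circ> maxim r) h \<in> W" "finite (p ` h) \<and> p ` h \<subseteq> W \<and> (p \<circ> maxim r) h \<in> p ` h"
    if "h \<in> H0" for h
  proof -
    have "h \<in> H" using that sub by blast
    then have "finite h" "maxim r h \<in> h" "p ` h \<subseteq> W"
      using unmeshed_member(1,4) p(2) by blast+
    then show "(p \<circ> maxim r) h \<in> W" "finite (p ` h) \<and> p ` h \<subseteq> W \<and> (p \<circ> maxim r) h \<in> p ` h"
      by auto
  qed
  have "\<exists>h\<in>H0. \<exists>G\<subseteq>H0. finite G \<and> card G = n - 1 \<and> (\<forall>g\<in>G. all_below r g h) \<and>
      odd (right_turns P t ((p \<circ> maxim r) h) (p ` h \<union> \<Union>((`) p ` G))) = b"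
    using n by (intro forking_tree.unions_of_both_parities[OF tree l chains tops inj large0 later]) auto
  then obtain h G where hG: "h \<in> H0" "G \<subseteq> H0" "finite G" "card G = n - 1"
    "\<And>g. g \<in> G \<Longrightarrow> all_below r g h"
    and odd: "odd (right_turns P t ((p \<circ> maxim r) h) (p ` h \<union> \<Union>((`) p ` G))) = b" by blast
  show thesis
  proof (rule that)
    have "h \<notin> G"
      using hG(5)[of h] all_below_iff_maxim[of h h] hG(1) sub by blast
    then show "insert h G \<in> nsets H n" using hG n sub unfolding nsets_def by auto
    have "\<Union>(insert h G) = h \<union> \<Union>G" "p ` (h \<union> \<Union>G) = p ` h \<union> \<Union>((`) p ` G)" by auto
    moreover have "maxim r (h \<union> \<Union>G) = maxim r h" using maxim_Union hG(1,2,5) sub by blast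
    ultimately show "odd (right_turns P t (p (maxim r (\<Union>(insert h G)))) (p ` \<Union>(insert h G))) = b"
      using odd by simp
  qed
qed

end

end

section \<open>Colourings without monochromatic unions\<close>

definition parity_colour ::
  "('v \<Rightarrow> 'v set) \<Rightarrow> ('v \<Rightarrow> 'v \<Rightarrow> bool) \<Rightarrow> 'a rel \<Rightarrow> ('a \<Rightarrow> 'v) \<Rightarrow> 'a set \<Rightarrow> nat" where
  "parity_colour P t r p x = of_bool (odd (right_turns P t (p (maxim r x)) (p ` x)))"

lemma parity_colour_neq_2: "parity_colour P t r p x \<noteq> 2"
  unfolding parity_colour_def by simp

lemma nsets_containing_pair:
  assumes "infinite H" "g \<in> H" "h \<in> H" "n \<ge> 2"
  obtains F where "F \<in> nsets H n" "g \<in> F" "h \<in> F"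
proof -
  have "infinite (H - {g, h})" using assms(1) by simp
  from infinite_arbitrarily_large[OF this, of "n - card {g, h}"]
  obtain G where G: "finite G" "card G = n - card {g, h}" "G \<subseteq> H - {g, h}" by blast
  have "card {g, h} \<le> 2" by (cases "g = h") auto
  moreover have "card (G \<union> {g, h}) = card G + card {g, h}"
    by (rule card_Un_disjoint) (use G in auto)
  ultimately have "card (G \<union> {g, h}) = n" using G(2) assms(4) by linarith
  then have "G \<union> {g, h} \<in> nsets H n" using G assms(2,3) unfolding nsets_def by auto
  then show thesis by (rule that) simp_all
qed

text \<open>
  The arity \<open>n = a + b\<close> is at least 2, so the unions mix several members of the family.
\<close>

lemma Hindman_Schur_unmeshed_fixed_arity:
  fixes c :: "'a set \<Rightarrow> nat"
  assumes "Hindman_Schur_unmeshed \<kappa> l" "c \<in> Fpow (Field \<kappa>) \<rightarrow> {0, 1, 2}"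
  obtains H n k where "unmeshed_family \<kappa> H" "|H| =o l" "n \<ge> 2"
    "\<And>F. F \<in> nsets H n \<Longrightarrow> c (\<Union>F) = k"
proof -
  obtain H a b where H: "unmeshed_family \<kappa> H" "|H| =o l" "0 < a" "0 < b"
    and mono: "is_monochromatic c (FU {a, b, a + b} H)"
    using assms(1)[unfolded Hindman_Schur_unmeshed_def, rule_format, OF assms(2)] by blast
  obtain k where k: "\<forall>x\<in>FU {a, b, a + b} H. c x = k"
    using mono unfolding is_monochromatic_def ..
  have "c (\<Union>F) = k" if "F \<in> nsets H (a + b)" for F
    by (rule bspec[OF k]) (use that in \<open>auto simp: FU_def\<close>)
  moreover have "a + b \<ge> 2" using H(3,4) by simp
  ultimately show thesis using that[OF H(1,2)] by blast
qed

lemma parity_colour_not_constant: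
  fixes l :: "'l rel" and p :: "'a \<Rightarrow> 'v"
  assumes r: "Well_order r" and H: "unmeshed_family r H"
    and l: "Cinfinite l" "regularCard l" "natLeq <o l"
    and tree: "forking_tree W P t"
    and chains: "\<And>C. C \<subseteq> W \<Longrightarrow> tree_chain P C \<Longrightarrow> |C| <o l"
    and large: "\<not> |H| <o l" and p: "inj_on p (\<Union>H)" "p ` \<Union>H \<subseteq> W" and n: "n \<ge> 2"
  shows "\<exists>F\<in>nsets H n. parity_colour P t r p (\<Union>F) \<noteq> k"
proof -
  obtain F where F: "F \<in> nsets H n" "odd (right_turns P t (p (maxim r (\<Union>F))) (p ` \<Union>F)) = (k \<noteq> 1)"
    by (rule unmeshed_unions_of_both_parities[OF r H l tree chains large p n])
  then have "parity_colour P t r p (\<Union>F) \<noteq> k" unfolding parity_colour_def by auto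
  then show ?thesis using F(1) by blast
qed

lemma not_Hindman_Schur_regular:
  fixes l :: "'l rel" and \<kappa> :: "'a rel"
  assumes \<kappa>: "Card_order \<kappa>" and l: "Cinfinite l" "regularCard l" "natLeq <o l"
    and tree: "forking_tree (Field \<kappa>) P t"
    and chains: "\<And>C. C \<subseteq> Field \<kappa> \<Longrightarrow> tree_chain P C \<Longrightarrow> |C| <o l"
  shows "\<not> Hindman_Schur_unmeshed \<kappa> l"
proof
  assume HS: "Hindman_Schur_unmeshed \<kappa> l"
  have col: "parity_colour P t \<kappa> id \<in> Fpow (Field \<kappa>) \<rightarrow> {0, 1, 2}"
    unfolding parity_colour_def by auto
  obtain H n k where H: "unmeshed_family \<kappa> H" "|H| =o l" "n \<ge> 2"
    and k: "\<And>F. F \<in> nsets H n \<Longrightarrow> parity_colour P t \<kappa> id (\<Union>F) = k"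
    by (rule Hindman_Schur_unmeshed_fixed_arity[OF HS col]) blast
  have wo: "Well_order \<kappa>" by (rule card_order_on_well_order_on[OF \<kappa>])
  have "\<Union>H \<subseteq> Field \<kappa>" using H(1) unfolding unmeshed_family_def Fpow_def by blast
  moreover have "\<not> |H| <o l" using not_ordLess_ordIso[of "|H|" l] H(2) by blast
  ultimately have "\<exists>F\<in>nsets H n. parity_colour P t \<kappa> id (\<Union>F) \<noteq> k"
    using H(3) by (intro parity_colour_not_constant[OF wo H(1) l tree chains]) auto
  then show False using k by blast
qed

text \<open>
  In a chain of the tree, the elements before \<open>\<sigma>\<close> in the well-order are nodes below \<open>\<sigma>\<close>.
\<close>

lemma narrow_chain_card:
  assumes r: "Well_order r" and q: "Card_order q" and C: "C \<subseteq> Field r" "tree_chain P C"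
    and lower: "\<And>\<alpha> \<beta>. \<alpha> \<in> P \<beta> \<Longrightarrow> (\<alpha>, \<beta>) \<in> r - Id"
    and narrow: "\<And>\<sigma>. \<sigma> \<in> C \<Longrightarrow> |P \<sigma>| <o q"
  shows "|C| \<le>o q"
proof (rule card_ordLeq_if_small_initial_segments[OF r C(1) q])
  fix \<sigma> assume \<sigma>: "\<sigma> \<in> C"
  have "underS r \<sigma> \<inter> C \<subseteq> P \<sigma>"
  proof
    fix \<tau> assume \<tau>: "\<tau> \<in> underS r \<sigma> \<inter> C"
    then have "(\<tau>, \<sigma>) \<in> r - Id" unfolding underS_def by blast
    then have "\<sigma> \<notin> P \<tau>" "\<tau> \<noteq> \<sigma>" using strict_asym[OF r] lower by blast+
    then show "\<tau> \<in> P \<sigma>" using C(2) \<sigma> \<tau> unfolding tree_chain_def by blast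
  qed
  then show "|underS r \<sigma> \<inter> C| <o q" by (rule ordLess_subset[OF _ narrow[OF \<sigma>]])
qed

text \<open>
  Let \<open>K\<close> be cofinal in \<open>l\<close> with fewer than \<open>l\<close> elements. The nodes with few predecessors, in the
  sense of \<open>k \<in> K\<close>, form a subtree \<open>V k\<close> with short chains, and these subtrees exhaust the
  tree, so that any proper initial segment of \<open>\<kappa>\<close> is smaller than one of them. Assigning to \<open>\<alpha>\<close> the first \<open>k\<close> for which \<open>V k\<close> is larger than the initial segment before \<open>\<alpha>\<close>
  divides \<open>\<kappa>\<close> into intervals, and the interval of \<open>k\<close> is no larger than \<open>V k\<close>. The levels of the tree
  themselves need not be intervals of \<open>\<kappa>\<close>; it takes intervals to exploit that \<open>H\<close> is unmeshed.
\<close>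

lemma not_Hindman_Schur_singular:
  fixes l :: "'l rel" and \<kappa> :: "'a rel"
  assumes \<kappa>: "Card_order \<kappa>" and l: "Cinfinite l" "\<not> regularCard l" "natLeq <o l"
    and tree: "forking_tree (Field \<kappa>) P t"
    and lower: "\<And>\<alpha> \<beta>. \<alpha> \<in> P \<beta> \<Longrightarrow> (\<alpha>, \<beta>) \<in> \<kappa> - Id"
    and chains: "\<And>C. C \<subseteq> Field \<kappa> \<Longrightarrow> tree_chain P C \<Longrightarrow> |C| <o l"
    and l\<kappa>: "l \<le>o \<kappa>"
  shows "\<not> Hindman_Schur_unmeshed \<kappa> l"
proof
  assume HS: "Hindman_Schur_unmeshed \<kappa> l"
  have wo: "Well_order \<kappa>" by (rule card_order_on_well_order_on[OF \<kappa>])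
  have wol: "Well_order l" "wo_rel l" using l(1) by (auto simp: wo_rel_def card_order_on_def)
  have infl: "infinite (Field l)" "Card_order l" using l(1) unfolding cinfinite_def by blast+
  obtain K where K: "K \<subseteq> Field l" "cofinal K l" "\<not> |K| =o l"
    using l(2) unfolding regularCard_def by blast
  have "|K| \<le>o l"
    by (rule ordLeq_ordIso_trans[OF card_of_mono1[OF K(1)] card_of_Field_ordIso[OF infl(2)]])
  then have K_less: "|K| <o l" using K(3) ordLeq_iff_ordLess_or_ordIso by blast
  have nat_less: "|UNIV :: nat set| <o l" by (rule ordIso_ordLess_trans[OF card_of_nat l(3)])
  have inf\<kappa>: "infinite (Field \<kappa>)"
    using card_of_mono2[OF l\<kappa>] card_of_ordLeq_infinite infl(1) by blast
  \<comment> \<open>adding a copy of the naturals makes \<open>|B k|\<close> infinite\<close>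
  define B where "B k = underS l k <+> (UNIV :: nat set)" for k
  define V where "V k = {\<sigma> \<in> Field \<kappa>. |P \<sigma>| \<le>o |B k| }" for k
  \<comment> \<open>a chain in \<open>V k\<close> can have \<open>cardSuc |B k|\<close> elements, hence the second successor\<close>
  define s where "s k = cardSuc (cardSuc |B k| )" for k
  have B_less: "|B k| <o l" if "k \<in> K" for k
    unfolding B_def
    using card_of_Plus_ordLess_infinite_Field[OF infl card_of_underS[OF infl(2)] nat_less] that K(1)
    by blast
  have B_inf: "Cinfinite |B k|" for k
    unfolding B_def by (rule Cinfinite_card_of) (simp add: finite_Plus_iff)
  have sB: "|B k| <o cardSuc |B k|" "cardSuc |B k| <o s k" for k
    unfolding s_def
    by (intro cardSuc_greater cardSuc_Card_order card_of_Card_order)+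
  have s: "Cinfinite (s k)" "regularCard (s k)" "natLeq <o s k" for k
  proof -
    have c: "Cinfinite (cardSuc |B k| )" by (rule Cinfinite_cardSuc[OF B_inf])
    show "Cinfinite (s k)" unfolding s_def by (rule Cinfinite_cardSuc[OF c])
    show "regularCard (s k)" unfolding s_def by (rule regularCard_cardSuc[OF c])
    show "natLeq <o s k" by (rule ordLeq_ordLess_trans[OF natLeq_ordLeq_cinfinite[OF c] sB(2)])
  qed
  have s_le: "s k \<le>o l" if "k \<in> K" for k
  proof -
    have c: "Cinfinite (cardSuc |B k| )" by (rule Cinfinite_cardSuc[OF B_inf])
    \<comment> \<open>\<open>l\<close> is singular, so it is no successor and \<open>cardSuc |B k|\<close> stays strictly below it\<close>
    have "cardSuc |B k| \<le>o l"
      by (rule cardSuc_least[OF card_of_Card_order infl(2) B_less[OF that]])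
    moreover have "\<not> cardSuc |B k| =o l"
      using regularCard_ordIso[OF _ c regularCard_cardSuc[OF B_inf], of l] l(2) by blast
    ultimately have "cardSuc |B k| <o l" using ordLeq_iff_ordLess_or_ordIso by blast
    then show ?thesis
      unfolding s_def using c infl(2) by (intro cardSuc_least) auto
  qed
  have V_tree: "forking_tree (V k) P t" for k
  proof (rule forking_tree.forking_tree_subset[OF tree])
    show "V k \<subseteq> Field \<kappa>" unfolding V_def by blast
    fix \<alpha> \<beta> assume *: "\<beta> \<in> V k" "\<alpha> \<in> P \<beta>"
    then have \<beta>: "\<beta> \<in> Field \<kappa>" "|P \<beta>| \<le>o |B k|" unfolding V_def by blast+
    have "P \<alpha> \<subseteq> P \<beta>" using forking_tree.below_trans[OF tree \<beta>(1) *(2)] by blast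
    then have "|P \<alpha>| \<le>o |B k|" by (rule ordLeq_transitive[OF card_of_mono1 \<beta>(2)])
    then show "\<alpha> \<in> V k" using forking_tree.below_in[OF tree \<beta>(1) *(2)] unfolding V_def by blast
  qed
  have V_chains: "|C| <o s k" if C: "C \<subseteq> V k" "tree_chain P C" for k C
  proof (rule ordLeq_ordLess_trans[OF narrow_chain_card[OF wo _ _ C(2) lower] sB(2)])
    show "Card_order (cardSuc |B k| )" by (rule cardSuc_Card_order[OF card_of_Card_order])
    show "C \<subseteq> Field \<kappa>" using C(1) unfolding V_def by blast
    show "|P \<sigma>| <o cardSuc |B k|" if "\<sigma> \<in> C" for \<sigma>
      by (rule ordLeq_ordLess_trans[OF _ sB(1)]) (use C(1) that in \<open>auto simp: V_def\<close>)
  qed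
  have V_cover: "\<exists>k\<in>K. \<sigma> \<in> V k" if \<sigma>: "\<sigma> \<in> Field \<kappa>" for \<sigma>
  proof -
    have "tree_chain P (P \<sigma>)"
      using forking_tree.below_linear[OF tree \<sigma>] unfolding tree_chain_def by blast
    moreover have "P \<sigma> \<subseteq> Field \<kappa>" using forking_tree.below_in[OF tree \<sigma>] by blast
    ultimately have "|P \<sigma>| <o l" by (intro chains)
    then obtain a where a: "a \<in> Field l" "|P \<sigma>| =o |underS l a|"
      by (rule ordLess_card_underS[OF wol(1) card_of_Card_order])
    obtain k where k: "k \<in> K" "(a, k) \<in> l" using K(2) a(1) unfolding cofinal_def by blast
    have "underS l a \<subseteq> underS l k"
      by (rule underS_incr[OF wo_rel.TRANS[OF wol(2)] wo_rel.ANTISYM[OF wol(2)] k(2)])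
    then have "|underS l a| \<le>o |B k|"
      unfolding B_def by (rule ordLeq_transitive[OF card_of_mono1 card_of_Plus1])
    then have "|P \<sigma>| \<le>o |B k|" by (rule ordIso_ordLeq_trans[OF a(2)])
    then show ?thesis using k(1) \<sigma> unfolding V_def by blast
  qed
  define Ks where "Ks \<alpha> = {k \<in> K. |underS \<kappa> \<alpha>| <o |V k| }" for \<alpha>
  define blk where "blk \<alpha> = wo_rel.minim l (Ks \<alpha>)" for \<alpha>
  have Ks_ne: "Ks \<alpha> \<noteq> {}" if \<alpha>: "\<alpha> \<in> Field \<kappa>" for \<alpha>
  proof
    assume "Ks \<alpha> = {}"
    then have V_le: "|V k| \<le>o |underS \<kappa> \<alpha>|" if "k \<in> K" for k
      using that not_ordLess_card_iff[of "|V k|" "underS \<kappa> \<alpha>"] unfolding Ks_def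
      by (auto simp: card_of_Card_order)
    let ?D = "K <+> (underS \<kappa> \<alpha> <+> (UNIV :: nat set))"
    have D_inf: "infinite ?D" by (simp add: finite_Plus_iff)
    have "|\<Union>k\<in>K. V k| \<le>o |?D|"
    proof (rule card_of_UNION_ordLeq_infinite[OF D_inf card_of_Plus1], intro ballI)
      fix k assume "k \<in> K"
      have "|underS \<kappa> \<alpha>| \<le>o |?D|"
        by (rule ordLeq_transitive[OF card_of_Plus1 card_of_Plus2])
      then show "|V k| \<le>o |?D|" by (rule ordLeq_transitive[OF V_le[OF \<open>k \<in> K\<close>]])
    qed
    moreover have "Field \<kappa> \<subseteq> (\<Union>k\<in>K. V k)" using V_cover by blast
    ultimately have "|Field \<kappa>| \<le>o |?D|" using ordLeq_transitive[OF card_of_mono1] by blast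
    moreover have "|?D| <o \<kappa>"
      using inf\<kappa> \<kappa> ordLess_ordLeq_trans[OF K_less l\<kappa>] card_of_underS[OF \<kappa> \<alpha>]
        ordLess_ordLeq_trans[OF nat_less l\<kappa>]
      by (intro card_of_Plus_ordLess_infinite_Field)
    ultimately have "|Field \<kappa>| <o \<kappa>" by (rule ordLeq_ordLess_trans)
    then show False using not_ordLess_ordIso card_of_Field_ordIso[OF \<kappa>] by blast
  qed
  have Ks_sub: "Ks \<alpha> \<subseteq> Field l" for \<alpha> using K(1) unfolding Ks_def by blast
  have blk_in: "blk \<alpha> \<in> Ks \<alpha>" if "\<alpha> \<in> Field \<kappa>" for \<alpha>
    unfolding blk_def by (rule wo_rel.minim_in[OF wol(2) Ks_sub Ks_ne[OF that]])
  have blk_mono: "(blk \<alpha>, blk \<beta>) \<in> l" if "(\<alpha>, \<beta>) \<in> \<kappa>" for \<alpha> \<beta>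
  proof -
    have \<beta>: "\<beta> \<in> Field \<kappa>" using that by (rule FieldI2)
    have "underS \<kappa> \<alpha> \<subseteq> underS \<kappa> \<beta>"
      using underS_incr[OF _ _ that] wo by (auto simp: order_on_defs)
    then have "Ks \<beta> \<subseteq> Ks \<alpha>" unfolding Ks_def using ordLess_subset by blast
    then have "blk \<beta> \<in> Ks \<alpha>" using blk_in[OF \<beta>] by blast
    then show ?thesis unfolding blk_def[of \<alpha>] by (rule wo_rel.minim_least[OF wol(2) Ks_sub])
  qed
  have "\<exists>f. inj_on f {\<alpha> \<in> Field \<kappa>. blk \<alpha> = k} \<and> f ` {\<alpha> \<in> Field \<kappa>. blk \<alpha> = k} \<subseteq> V k" for k
  proof -
    let ?D = "{\<alpha> \<in> Field \<kappa>. blk \<alpha> = k}"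
    have "|?D| \<le>o |V k|"
    proof (rule card_ordLeq_if_small_initial_segments[OF wo _ card_of_Card_order])
      fix a assume a: "a \<in> ?D"
      then have "|underS \<kappa> a| <o |V k|" using blk_in[of a] unfolding Ks_def by auto
      then show "|underS \<kappa> a \<inter> ?D| <o |V k|" by (rule ordLess_subset[rotated]) blast
    qed blast
    then show ?thesis unfolding card_of_ordLeq[symmetric] .
  qed
  then have "\<forall>k. \<exists>f. inj_on f {\<alpha> \<in> Field \<kappa>. blk \<alpha> = k} \<and> f ` {\<alpha> \<in> Field \<kappa>. blk \<alpha> = k} \<subseteq> V k" ..
  from choice[OF this] obtain f where f: "\<And>k. inj_on (f k) {\<alpha> \<in> Field \<kappa>. blk \<alpha> = k}"
    "\<And>k. f k ` {\<alpha> \<in> Field \<kappa>. blk \<alpha> = k} \<subseteq> V k" by blast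
  define c where "c x = (if \<exists>k. \<forall>u\<in>x. blk u = k
      then parity_colour P t \<kappa> (f (blk (maxim \<kappa> x))) x else 2)" for x
  have col: "c \<in> Fpow (Field \<kappa>) \<rightarrow> {0, 1, 2}"
    unfolding c_def parity_colour_def by auto
  obtain H n k where H: "unmeshed_family \<kappa> H" "|H| =o l" "n \<ge> 2"
    and k: "\<And>F. F \<in> nsets H n \<Longrightarrow> c (\<Union>F) = k"
    by (rule Hindman_Schur_unmeshed_fixed_arity[OF HS col]) blast
  have HF: "\<Union>H \<subseteq> Field \<kappa>" using H(1) unfolding unmeshed_family_def Fpow_def by blast
  have large: "\<not> |H| <o l" using not_ordLess_ordIso[of "|H|" l] H(2) by blast
  then have infH: "infinite H" using ordLess_finite[OF l(1), of H] by blast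
  note mem = unmeshed_member[OF wo H(1)]
  show False
  proof (cases "k = 2")
    case True
    \<comment> \<open>unmeshedness puts all members with maximum in block \<open>j\<close>, except the first, inside that block;
        as \<open>n\<close>-fold unions inside a block do not have colour 2, there are finitely many\<close>
    define Q where "Q j = {h \<in> H. blk (maxim \<kappa> h) = j}" for j
    have Q_fin: "finite (Q j)" for j
    proof (rule ccontr)
      assume Q: "infinite (Q j)"
      have Qsub: "maxim \<kappa> ` Q j \<subseteq> Field \<kappa>" using mem(4) HF unfolding Q_def by blast
      have wo\<kappa>: "wo_rel \<kappa>" using wo by (simp add: wo_rel_def)
      have "maxim \<kappa> ` Q j \<noteq> {}" using Q by auto
      then have "wo_rel.minim \<kappa> (maxim \<kappa> ` Q j) \<in> maxim \<kappa> ` Q j"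
        by (rule wo_rel.minim_in[OF wo\<kappa> Qsub])
      then obtain g where g: "g \<in> Q j" "wo_rel.minim \<kappa> (maxim \<kappa> ` Q j) = maxim \<kappa> g" by blast
      have first: "(maxim \<kappa> g, maxim \<kappa> h) \<in> \<kappa>" if "h \<in> Q j" for h
        using wo_rel.minim_least[OF wo\<kappa> Qsub, of "maxim \<kappa> h"] that unfolding g(2) by blast
      have blk_j: "blk u = j" if h: "h \<in> Q j - {g}" and u: "u \<in> h" for h u
      proof -
        have gh: "g \<in> H" "h \<in> H" "g \<noteq> h" using g h unfolding Q_def by blast+
        have "all_below \<kappa> g h"
          using maxim_linear[OF wo H(1) gh] strict_asym[OF wo] first h by blast
        then have "(maxim \<kappa> g, u) \<in> \<kappa>" using mem(4)[OF gh(1)] u unfolding all_below_def by blast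
        then have "(blk (maxim \<kappa> g), blk u) \<in> l" by (rule blk_mono)
        moreover have "(blk u, blk (maxim \<kappa> h)) \<in> l" by (rule blk_mono[OF mem(5)[OF gh(2) u]])
        moreover have "blk (maxim \<kappa> g) = j" "blk (maxim \<kappa> h) = j" using g h unfolding Q_def by auto
        ultimately show ?thesis using antisymD[OF wo_rel.ANTISYM[OF wol(2)]] by simp
      qed
      have "infinite (Q j - {g})" using Q by simp
      then obtain F where F: "F \<subseteq> Q j - {g}" "finite F" "card F = n"
        using infinite_arbitrarily_large by blast
      then have "F \<in> nsets H n" unfolding nsets_def Q_def by blast
      then have "c (\<Union>F) = 2" using k True by simp
      moreover have "\<forall>u\<in>\<Union>F. blk u = j" using blk_j F(1) by blast
      ultimately show False unfolding c_def by (auto simp: parity_colour_neq_2 split: if_splits)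
    qed
    let ?D = "K <+> (UNIV :: nat set)"
    have D_inf: "infinite ?D" by (simp add: finite_Plus_iff)
    have "|\<Union>j\<in>K. Q j| \<le>o |?D|"
    proof (rule card_of_UNION_ordLeq_infinite[OF D_inf card_of_Plus1], intro ballI)
      fix j
      have "|Q j| <o |?D|"
        by (rule ordLess_finite[OF Cinfinite_card_of[OF D_inf] Q_fin])
      then show "|Q j| \<le>o |?D|" by (rule ordLess_imp_ordLeq)
    qed
    moreover have "H \<subseteq> (\<Union>j\<in>K. Q j)"
    proof
      fix h assume h: "h \<in> H"
      then have "blk (maxim \<kappa> h) \<in> K" using blk_in mem(4) HF unfolding Ks_def by blast
      then show "h \<in> (\<Union>j\<in>K. Q j)" using h unfolding Q_def by blast
    qed
    ultimately have "|H| \<le>o |?D|" using ordLeq_transitive[OF card_of_mono1] by blast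
    moreover have "|?D| <o l"
      by (rule card_of_Plus_ordLess_infinite_Field[OF infl K_less nat_less])
    ultimately have "|H| <o l" by (rule ordLeq_ordLess_trans)
    then show False using large by blast
  next
    case False
    \<comment> \<open>any two members lie in a common \<open>n\<close>-fold union, which is inside one block\<close>
    have "H \<noteq> {}" using infH by auto
    then obtain g where g: "g \<in> H" by blast
    define j where "j = blk (maxim \<kappa> g)"
    have one_block: "blk u = j" if h: "h \<in> H" and u: "u \<in> h" for h u
    proof -
      obtain F where F: "F \<in> nsets H n" "g \<in> F" "h \<in> F"
        by (rule nsets_containing_pair[OF infH g h H(3)])
      have "c (\<Union>F) \<noteq> 2" unfolding k[OF F(1)] by (rule False)
      then obtain i where i: "\<forall>u\<in>\<Union>F. blk u = i" unfolding c_def by presburger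
      then have "blk u = i" using u F(3) by blast
      moreover have "blk (maxim \<kappa> g) = i" using i F(2) mem(4)[OF g] by blast
      ultimately show ?thesis unfolding j_def by simp
    qed
    have jK: "j \<in> K" using blk_in mem(4)[OF g] g HF unfolding j_def Ks_def by blast
    have HD: "\<Union>H \<subseteq> {\<alpha> \<in> Field \<kappa>. blk \<alpha> = j}" using one_block HF by blast
    have large_j: "\<not> |H| <o s j"
      using ordLess_ordLeq_trans[OF _ s_le[OF jK], of "|H|"] large by argo
    have inj: "inj_on (f j) (\<Union>H)" by (rule inj_on_subset[OF f(1) HD])
    have img: "f j ` \<Union>H \<subseteq> V j" by (rule order_trans[OF image_mono[OF HD] f(2)])
    from parity_colour_not_constant[OF wo H(1) s V_tree V_chains large_j inj img H(3), where k = k]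
    obtain F where F: "F \<in> nsets H n" "parity_colour P t \<kappa> (f j) (\<Union>F) \<noteq> k" by blast
    have FH: "\<Union>F \<subseteq> \<Union>H" using F(1) unfolding nsets_def by blast
    have FH': "F \<noteq> {}" "F \<subseteq> H" "finite F" using F(1) H(3) unfolding nsets_def by auto
    have "finite (\<Union>F)" using FH'(2,3) mem(1) by (intro finite_Union) blast+
    moreover have "\<Union>F \<noteq> {}" using FH'(1,2) mem(2) by blast
    ultimately have "maxim \<kappa> (\<Union>F) \<in> \<Union>F"
      by (rule maxim_greatest(1)[OF wo _ _ order_trans[OF FH HF]])
    then have "blk (maxim \<kappa> (\<Union>F)) = j" using FH HD by blast
    moreover have "\<forall>u\<in>\<Union>F. blk u = j" using FH HD by blast
    ultimately have "c (\<Union>F) = parity_colour P t \<kappa> (f j) (\<Union>F)"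
      unfolding c_def by (metis (no_types, lifting))
    then show False using F(2) k[OF F(1)] by argo
  qed
qed

section \<open>The partition relation\<close>

text \<open>The maxima of the members of an unmeshed family are distinct elements of \<open>\<kappa>\<close>.\<close>

lemma Hindman_Schur_unmeshed_ordLeq:
  assumes "Card_order \<kappa>" "Hindman_Schur_unmeshed \<kappa> l"
  shows "l \<le>o \<kappa>"
proof -
  have wo: "Well_order \<kappa>" by (rule card_order_on_well_order_on[OF assms(1)])
  have "(\<lambda>_. 0 :: nat) \<in> Fpow (Field \<kappa>) \<rightarrow> {0, 1, 2}" by simp
  then obtain H where H: "unmeshed_family \<kappa> H" "|H| =o l"
    by (rule Hindman_Schur_unmeshed_fixed_arity[OF assms(2)])
  have "maxim \<kappa> ` H \<subseteq> Field \<kappa>" using unmeshed_member(3,4)[OF wo H(1)] by blast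
  then have "|H| \<le>o |Field \<kappa>|"
    using inj_on_maxim[OF wo H(1)] unfolding card_of_ordLeq[symmetric] by blast
  then have "|H| \<le>o \<kappa>" by (rule ordLeq_ordIso_trans[OF _ card_of_Field_ordIso[OF assms(1)]])
  then show ?thesis by (rule ordIso_ordLeq_trans[OF ordIso_symmetric[OF H(2)]])
qed

theorem corollary1:
  fixes \<kappa> :: "'a rel" and l :: "'b rel"
  assumes "Card_order l" and "infinite (Field l)"
    and "Card_order \<kappa>"
    and "Hindman_Schur_unmeshed \<kappa> l"
  shows "arrows_pairs \<kappa> l"
  unfolding arrows_pairs_def
proof (intro allI impI ballI)
  fix S :: "'a set" and f :: "'a set \<Rightarrow> nat"
  assume S: "|S| =o \<kappa>" and f: "f \<in> nsets S 2 \<rightarrow> {0, 1}"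
  have l: "Cinfinite l" using assms(1,2) by (simp add: cinfinite_def)
  have l\<kappa>: "l \<le>o \<kappa>" by (rule Hindman_Schur_unmeshed_ordLeq[OF assms(3,4)])
  have lS: "l \<le>o |S|" by (rule ordLeq_ordIso_trans[OF l\<kappa> ordIso_symmetric[OF S]])
  show "\<exists>X\<subseteq>S. |X| =o l \<and> is_monochromatic f (nsets X 2)"
  proof (cases "natLeq <o l")
    case False
    then have l_nat: "l \<le>o natLeq"
      using not_ordLess_iff_ordLeq[of l natLeq] natLeq_Well_order
        card_order_on_well_order_on[OF assms(1)] by simp
    have "natLeq \<le>o |S|" by (rule ordLeq_transitive[OF natLeq_ordLeq_cinfinite[OF l] lS])
    then have "infinite S" using infinite_iff_natLeq_ordLeq by blast
    moreover have "\<forall>x. x \<subseteq> S \<and> finite x \<and> card x = 2 \<longrightarrow> f x < 2"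
    proof (intro allI impI)
      fix x assume "x \<subseteq> S \<and> finite x \<and> card x = 2"
      then have "x \<in> nsets S 2" unfolding nsets_def by blast
      then have "f x \<in> {0, 1}" using f by blast
      then show "f x < 2" by auto
    qed
    ultimately obtain Y k where Y: "Y \<subseteq> S" "infinite Y"
      and k: "\<forall>x. x \<subseteq> Y \<and> finite x \<and> card x = 2 \<longrightarrow> f x = k"
      using Ramsey[of S 2 f 2] by blast
    have "natLeq \<le>o |Y|" using Y(2) infinite_iff_natLeq_ordLeq by blast
    then have "l \<le>o |Y|" by (rule ordLeq_transitive[OF l_nat])
    then obtain X where X: "X \<subseteq> Y" "|X| =o l" by (rule subset_of_cardinality[OF assms(1)])
    have "is_monochromatic f (nsets X 2)"
      unfolding is_monochromatic_def
    proof (intro exI ballI)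
      fix x assume "x \<in> nsets X 2"
      then have "x \<subseteq> Y \<and> finite x \<and> card x = 2" using X(1) unfolding nsets_def by blast
      then show "f x = k" using k by simp
    qed
    then show ?thesis using X Y(1) by blast
  next
    case True
    have wo: "Well_order \<kappa>" by (rule card_order_on_well_order_on[OF assms(3)])
    have "|Field \<kappa>| =o |S|"
      by (rule ordIso_transitive[OF card_of_Field_ordIso[OF assms(3)] ordIso_symmetric[OF S]])
    then obtain \<phi> where \<phi>: "bij_betw \<phi> (Field \<kappa>) S" unfolding card_of_ordIso[symmetric] by blast
    define t where "t \<alpha> \<beta> = (f {\<phi> \<alpha>, \<phi> \<beta>} = 1)" for \<alpha> \<beta>
    define P where "P = ramification (\<kappa> - Id) t"
    have tree: "forking_tree (Field \<kappa>) P t" unfolding P_def by (rule forking_tree_ramification[OF wo])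
    have lower: "(\<alpha>, \<beta>) \<in> \<kappa> - Id" if "\<alpha> \<in> P \<beta>" for \<alpha> \<beta>
      using that ramification_iff[of "\<kappa> - Id" \<alpha> t \<beta>] wo unfolding P_def by (simp add: order_on_defs)
    have "\<exists>C. C \<subseteq> Field \<kappa> \<and> tree_chain P C \<and> \<not> |C| <o l"
    proof (rule ccontr)
      assume "\<not> ?thesis"
      then have chains: "|C| <o l" if "C \<subseteq> Field \<kappa>" "tree_chain P C" for C
        using that by simp
      show False
      proof (cases "regularCard l")
        case reg: True
        show False by (rule notE[OF not_Hindman_Schur_regular[OF assms(3) l reg True tree chains] assms(4)])
      next
        case sing: False
        show False
          by (rule notE[OF not_Hindman_Schur_singular[OF assms(3) l sing True tree lower chains l\<kappa>]
              assms(4)])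
      qed
    qed
    then obtain C where C: "C \<subseteq> Field \<kappa>" "tree_chain P C" "\<not> |C| <o l" by blast
    obtain X b where X: "X \<subseteq> C" "|X| =o l"
      and b: "\<And>\<alpha> \<beta>. \<alpha> \<in> X \<Longrightarrow> \<beta> \<in> X \<Longrightarrow> \<alpha> \<in> P \<beta> \<Longrightarrow> t \<alpha> \<beta> = b"
      by (rule forking_tree.homogeneous_subset_of_large_chain[OF tree l C]) blast
    have XF: "X \<subseteq> Field \<kappa>" using X(1) C(1) by blast
    have \<phi>X: "\<phi> ` X \<subseteq> S" using bij_betw_imp_surj_on[OF \<phi>] XF by blast
    have "bij_betw \<phi> X (\<phi> ` X)" by (rule bij_betw_subset[OF \<phi> XF refl])
    then have "|X| =o |\<phi> ` X|" unfolding card_of_ordIso[symmetric] by blast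
    then have card: "|\<phi> ` X| =o l" by (rule ordIso_transitive[OF ordIso_symmetric X(2)])
    have "f x = of_bool b" if x: "x \<in> nsets (\<phi> ` X) 2" for x
    proof -
      have "x \<subseteq> \<phi> ` X" "card x = 2" using x unfolding nsets_def by blast+
      then obtain u v where uv: "x = {u, v}" "u \<noteq> v" unfolding card_2_iff by blast
      then obtain \<alpha> \<beta> where "u = \<phi> \<alpha>" "v = \<phi> \<beta>" "\<alpha> \<in> X" "\<beta> \<in> X"
        using \<open>x \<subseteq> \<phi> ` X\<close> by blast
      then have ab: "x = {\<phi> \<alpha>, \<phi> \<beta>}" "\<alpha> \<in> X" "\<beta> \<in> X" "\<alpha> \<noteq> \<beta>" using uv by auto
      have "\<alpha> \<in> P \<beta> \<or> \<beta> \<in> P \<alpha>" using C(2) ab X(1) unfolding tree_chain_def by blast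
      then have "t \<alpha> \<beta> = b \<or> t \<beta> \<alpha> = b" using b ab(2,3) by blast
      moreover have "t \<beta> \<alpha> = t \<alpha> \<beta>" unfolding t_def by (simp only: insert_commute)
      ultimately have "(f x = 1) = b" unfolding ab(1) by (simp add: t_def)
      moreover have "x \<in> nsets S 2" using x \<phi>X unfolding nsets_def by blast
      then have "f x \<in> {0, 1}" using f by blast
      ultimately show ?thesis by (cases b) simp_all
    qed
    then have "is_monochromatic f (nsets (\<phi> ` X) 2)"
      unfolding is_monochromatic_def by (intro exI ballI)
    then show ?thesis using card \<phi>X by blast
  qed
qed

end
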